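(* Let $n\geq 2$ and let $\Pi_1,\Pi_2,\dots,\Pi_{n+1}$ be hyperplanes in $n$-dimensional hyperbolic space $H^n$. These hyperplanes can be endowed with coorientations such that $\det C=0$, where $C$ is the $(n+1)\times(n+1)$ matrix with entries $C_{ij}=\sigma(\Pi_i,\Pi_j)$, if and only if at least one of the following holds: the hyperplanes $\Pi_1,\dots,\Pi_{n+1}$ (i) share a common tangent hyperplane at infinity (that is, there is a hyperplane $\Pi$ whose ideal boundary is tangent or equal to the ideal boundary of each $\Pi_i$), (ii) share a common ideal point, or (iii) are all orthogonal to one hyperplane and equally inclined (in the unoriented sense) to another.
   Context: Let $\varrho$ be the distance function of $H^n$. Each hyperplane in $H^n$ has two unit normal vector fields, one the negative of the other; a cooriented hyperplane is a hyperplane $\Pi$ together with a choice of one of these two fields (again denoted $\Pi$). For cooriented hyperplanes $\Pi,\Pi'$ define $\sigma(\Pi,\Pi')$ as follows. When $\Pi,\Pi'$ are disjoint and not tangent at infinity, let $\gamma$ be their common perpendicular geodesic; then $\sigma(\Pi,\Pi')=\sinh^2\tfrac12\varrho(\Pi,\Pi')$ if the normal coorientations coincide along $\gamma$, and $\sigma(\Pi,\Pi')=-\cosh^2\tfrac12\varrho(\Pi,\Pi')$ if the normal coorientations are opposite along $\gamma$. When $\Pi\cap\Pi'\neq\varnothing$, $\sigma(\Pi,\Pi')=-\sin^2\tfrac12\theta$, where $\theta$ is the angle between the two normals at a point of intersection. When $\Pi,\Pi'$ are tangent at infinity (disjoint in $H^n$ with ideal boundaries meeting in exactly one point), $\sigma(\Pi,\Pi')$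 is $0$ if the normal coorientations coincide along a common perpendicular horosphere and $-1$ if they are opposite along a common perpendicular horosphere. Lorentzian description: let $\mathbb{R}^{n,1}$ be $\mathbb{R}^{n+1}$ with the inner product $\langle x,y\rangle=x_1y_1+\dots+x_ny_n-x_{n+1}y_{n+1}$, and $\|x\|^2=\langle x,x\rangle$; $x$ is spacelike, timelike, or lightlike according to whether $\|x\|^2$ is positive, negative, or zero. $H^n$ is modelled by $\mathcal{H}^n=\{x\in\mathbb{R}^{n,1}:\|x\|^2=-1,\ x_{n+1}>0\}$ with $\cosh\varrho(x,y)=-\langle x,y\rangle$. A hyperplane is the nonempty intersection of $\mathcal{H}^n$ with a codimension 1 subspace of $\mathbb{R}^{n,1}$; it equals $\{x\in\mathcal{H}^n:\langle x,v\rangle=0\}$ for a spacelike unit normal $v$ ($\|v\|^2=1$), unique up to sign, and a coorientation is a choice of this sign. The ideal boundary of $H^n$ is the set of lines of lightlike vectors, and the ideal points of a hyperplane with normal $v$ are the lightlike lines orthogonal to $v$. If $\Pi,\Pi'$ are cooriented by spacelike unit normals $v,v'$, then $\sigma(\Pi,\Pi')=\tfrac12(\langle v,v'\rangle-1)$. With $v_i$ a spacelike unit normal to $\Pi_i$ (either sign), the three statements mean: (i) there is a spacelike unit vector $v$ with $|\langle v_i,v\rangle|=1$ for all $i$; (ii) there is a (nonzero) lightlike vector $w$ with $\langle v_i,w\rangle=0$ for all $i$; (iii) there are linearly independent spacelike unit vectors $u$ and $v$ and a real number $0\leq\lambda<1$ with $\langle v_i,u\rangle=0$ and $|\langle v_i,v\rangle|=\lambda$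 for all $i$. *)

theory Defs
  imports "HOL-Analysis.Analysis"
begin

text \<open>
  Lorentzian space $R^{n,1}$ is the type \<^typ>\<open>(real^'n) \<times> real\<close> with $n$ = \<^term>\<open>CARD('n)\<close>;
  the second component is the timelike coordinate $x_{n+1}$.
\<close>

type_synonym 'n lorentz = "(real^'n) \<times> real"

definition lor :: "'n::finite lorentz \<Rightarrow> 'n lorentz \<Rightarrow> real" where
  "lor x y = fst x \<bullet> fst y - snd x * snd y"

definition spacelike_unit :: "'n::finite lorentz \<Rightarrow> bool" where
  "spacelike_unit v \<longleftrightarrow> lor v v = 1"

definition lightlike :: "'n::finite lorentz \<Rightarrow> bool" where
  "lightlike w \<longleftrightarrow> w \<noteq> 0 \<and> lor w w = 0"

definition hyp_space :: "'n::finite lorentz set" where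
  "hyp_space = {x. lor x x = -1 \<and> snd x > 0}"

definition hdist :: "'n::finite lorentz \<Rightarrow> 'n lorentz \<Rightarrow> real" where
  "hdist x y = arcosh (- lor x y)"

definition hset_dist :: "'n::finite lorentz set \<Rightarrow> 'n lorentz set \<Rightarrow> real" where
  "hset_dist A B = (INF (x, y) \<in> A \<times> B. hdist x y)"

definition hyperplane :: "'n::finite lorentz set \<Rightarrow> bool" where
  "hyperplane P \<longleftrightarrow>
     (\<exists>V. subspace V \<and> dim V = CARD('n) \<and> P = hyp_space \<inter> V \<and> P \<noteq> {})"

definition perp_plane :: "'n::finite lorentz \<Rightarrow> 'n lorentz set" where
  "perp_plane v = {x \<in> hyp_space. lor x v = 0}"

text \<open>
  The tangent space of hyperbolic space at \<open>x\<close> is the Lorentz-orthogonal complement of \<open>x\<close>.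
  Hence a unit normal vector field along a hyperplane is a constant spacelike unit vector \<open>v\<close>,
  and \<open>v\<close> determines the hyperplane as \<^term>\<open>perp_plane v\<close>. A cooriented hyperplane is
  therefore represented by such a vector, and \<open>unit_normal P v\<close> says that \<open>v\<close> coorients \<open>P\<close>.
\<close>

definition unit_normal :: "'n::finite lorentz set \<Rightarrow> 'n lorentz \<Rightarrow> bool" where
  "unit_normal P v \<longleftrightarrow> spacelike_unit v \<and> P = perp_plane v"

text \<open>Ideal points are lightlike lines, taken as one-dimensional subspaces.\<close>

definition ideal_boundary :: "'n::finite lorentz set \<Rightarrow> 'n lorentz set set" where
  "ideal_boundary P =
     {span {w} | w. lightlike w \<and> (\<exists>v. unit_normal P v \<and> lor w v = 0)}"

definition tangent_at_infinity :: "'n::finite lorentz set \<Rightarrow> 'n lorentz set \<Rightarrow> bool" where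
  "tangent_at_infinity P Q \<longleftrightarrow>
     P \<inter> Q = {} \<and> (\<exists>!L. L \<in> ideal_boundary P \<inter> ideal_boundary Q)"

definition geodesic :: "(real \<Rightarrow> 'n::finite lorentz) \<Rightarrow> bool" where
  "geodesic c \<longleftrightarrow> (\<exists>p u. p \<in> hyp_space \<and> lor u u = 1 \<and> lor p u = 0 \<and>
     c = (\<lambda>t. cosh t *\<^sub>R p + sinh t *\<^sub>R u))"

text \<open>
  Every horosphere has the form \<open>horosphere w\<close> for a unique lightlike \<open>w\<close>; it is centred at the
  ideal point spanned by \<open>w\<close>, and it is perpendicular to \<^term>\<open>perp_plane v\<close> precisely if
  \<open>lor v w = 0\<close>. In its induced metric it is a Euclidean space, whose unit speed straight lines
  are the horocycles \<open>horosphere_line w\<close>.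
\<close>

definition horosphere :: "'n::finite lorentz \<Rightarrow> 'n lorentz set" where
  "horosphere w = {x \<in> hyp_space. lor x w = -1}"

definition horosphere_line :: "'n::finite lorentz \<Rightarrow> (real \<Rightarrow> 'n lorentz) \<Rightarrow> bool" where
  "horosphere_line w c \<longleftrightarrow>
     (\<exists>x u. x \<in> horosphere w \<and> lor u u = 1 \<and> lor x u = 0 \<and> lor w u = 0 \<and>
       c = (\<lambda>t. x + t *\<^sub>R u + (t\<^sup>2 / 2) *\<^sub>R w))"

text \<open>
  A unit speed curve \<open>c\<close> crosses the planes of \<open>v\<close> and \<open>v'\<close> perpendicularly, and traverses the
  two normals in the same sense (both along \<open>c\<close>, or both against it).
\<close>

definition coincide_along ::
    "(real \<Rightarrow> 'n::finite lorentz) \<Rightarrow> 'n lorentz \<Rightarrow> 'n lorentz \<Rightarrow> bool" where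
  "coincide_along c v v' \<longleftrightarrow>
     (\<exists>s t e. e \<in> {1, -1} \<and> c s \<in> perp_plane v \<and> c t \<in> perp_plane v' \<and>
        (c has_vector_derivative e *\<^sub>R v) (at s) \<and>
        (c has_vector_derivative e *\<^sub>R v') (at t))"

definition coincide_along_geodesic :: "'n::finite lorentz \<Rightarrow> 'n lorentz \<Rightarrow> bool" where
  "coincide_along_geodesic v v' \<longleftrightarrow> (\<exists>c. geodesic c \<and> coincide_along c v v')"

definition coincide_along_horosphere :: "'n::finite lorentz \<Rightarrow> 'n lorentz \<Rightarrow> bool" where
  "coincide_along_horosphere v v' \<longleftrightarrow>
     (\<exists>w c. lightlike w \<and> lor v w = 0 \<and> lor v' w = 0 \<and>
        horosphere_line w c \<and> coincide_along c v v')"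

text \<open>
  In the two disjoint cases the coorientations either coincide or are opposite, so the
  opposite case is the \<open>else\<close> branch. At a point of intersection both normals lie in the
  tangent space, on which \<^const>\<open>lor\<close> is the Riemannian metric, so their angle is
  \<open>arccos (lor v v')\<close>; this case includes coinciding hyperplanes.
\<close>

definition coor_sigma :: "'n::finite lorentz \<Rightarrow> 'n lorentz \<Rightarrow> real" where
  "coor_sigma v v' =
     (let P = perp_plane v; P' = perp_plane v' in
      if P \<inter> P' \<noteq> {} then - (sin (arccos (lor v v') / 2))\<^sup>2
      else if tangent_at_infinity P P' then
        (if coincide_along_horosphere v v' then 0 else -1)
      else
        (if coincide_along_geodesic v v' then (sinh (hset_dist P P' / 2))\<^sup>2
         else - (cosh (hset_dist P P' / 2))\<^sup>2))"

definition orthogonal_planes :: "'n::finite lorentz set \<Rightarrow> 'n lorentz set \<Rightarrow> bool" where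
  "orthogonal_planes P Q \<longleftrightarrow>
     (\<exists>v u. unit_normal P v \<and> unit_normal Q u \<and> lor v u = 0)"

text \<open>
  For \<open>0 \<le> l < 1\<close>, \<open>inclined l P Q\<close> says that \<open>P\<close> and \<open>Q\<close> are distinct, meet,
  and form the unoriented angle \<open>arccos l\<close>.
\<close>

definition inclined :: "real \<Rightarrow> 'n::finite lorentz set \<Rightarrow> 'n lorentz set \<Rightarrow> bool" where
  "inclined l P Q \<longleftrightarrow>
     (\<exists>v u. unit_normal P v \<and> unit_normal Q u \<and> \<bar>lor v u\<bar> = l)"

definition share_tangent_hyperplane :: "('m \<Rightarrow> 'n::finite lorentz set) \<Rightarrow> bool" where
  "share_tangent_hyperplane P \<longleftrightarrow>
     (\<exists>Q. hyperplane Q \<and>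
        (\<forall>i. tangent_at_infinity Q (P i) \<or> ideal_boundary Q = ideal_boundary (P i)))"

definition share_ideal_point :: "('m \<Rightarrow> 'n::finite lorentz set) \<Rightarrow> bool" where
  "share_ideal_point P \<longleftrightarrow> (\<exists>L. \<forall>i. L \<in> ideal_boundary (P i))"

definition orthogonal_and_equally_inclined :: "('m \<Rightarrow> 'n::finite lorentz set) \<Rightarrow> bool" where
  "orthogonal_and_equally_inclined P \<longleftrightarrow>
     (\<exists>Q R l. hyperplane Q \<and> hyperplane R \<and> Q \<noteq> R \<and> 0 \<le> l \<and> l < 1 \<and>
        (\<forall>i. orthogonal_planes (P i) Q \<and> inclined l (P i) R))"

end

theory Submission
  imports Defs
begin

text \<open>
  Write \<open>v i\<close> for unit normals of the hyperplanes. In every relative position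
  \<open>coor_sigma v v' = (lor v v' - 1) / 2\<close> (lemma \<open>coor_sigma_eq\<close>), so up to a factor the matrix is
  the Gram matrix of the normals with \<open>1\<close> subtracted from each entry. It is singular precisely
  if there are coefficients, not all zero, such that the combination \<open>w\<close> of the normals with these
  coefficients satisfies \<open>lor (v i) w = s\<close> for all \<open>i\<close>, where \<open>s\<close> is the sum of the coefficients.

  Such a combination has \<open>lor w w = s\<^sup>2\<close>. If \<open>s \<noteq> 0\<close>, then \<open>w\<close> divided by \<open>s\<close> is the normal of a
  hyperplane tangent to all the given ones. If \<open>s = 0\<close> and \<open>w \<noteq> 0\<close>, then \<open>w\<close> is a common ideal
  point. If both vanish, then the extended vectors \<open>(v i, 1)\<close> are dependent; as there are only
  \<open>n + 1\<close> of them in a space of dimension \<open>n + 2\<close>, two independent pairs \<open>(a, t)\<close> satisfy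
  \<open>lor (v i) a = t\<close> for all \<open>i\<close>. The signatures of the vectors \<open>a\<close> then decide which of the three
  alternatives occurs (\<open>plane_lightlike_or_positive\<close>, \<open>affine_family_alternatives\<close>).

  Conversely, after a suitable choice of signs each alternative confines the normals, or vectors
  derived from them, to a space of dimension at most \<open>n\<close>, where \<open>n + 1\<close> vectors are dependent:
  the complement of \<open>z\<close> for the differences \<open>v i - z\<close> when \<open>z\<close> is a common tangent normal; the
  complement of \<open>w\<close> modulo \<open>w\<close>, with one dimension added for the coefficient sum, when \<open>w\<close> is a
  common ideal point; and a subspace of codimension two for the extended vectors in the
  remaining alternative.

  The geometric input, in the formula for sigma as well as in the case distinction by signature,
  is mainly that the complement of a timelike vector is positive definite
  (\<open>orthogonal_timelike_pos\<close>).
\<close>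

section \<open>The Lorentzian inner product\<close>

lemma lor_commute: "lor x y = lor y x"
  by (simp add: lor_def inner_commute mult.commute)

lemma lor_simps:
  "lor (x + y) z = lor x z + lor y z" "lor x (y + z) = lor x y + lor x z"
  "lor (x - y) z = lor x z - lor y z" "lor x (y - z) = lor x y - lor x z"
  "lor (a *\<^sub>R x) z = a * lor x z" "lor x (a *\<^sub>R z) = a * lor x z"
  "lor (- x) z = - lor x z" "lor x (- z) = - lor x z"
  "lor 0 z = 0" "lor x 0 = 0"
  by (simp_all add: lor_def inner_simps algebra_simps)

lemma lor_sum_left: "lor (sum f A) z = (\<Sum>i\<in>A. lor (f i) z)"
  by (induction A rule: infinite_finite_induct) (simp_all add: lor_simps)

lemma lor_sum_right: "lor z (sum f A) = (\<Sum>i\<in>A. lor z (f i))"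
  by (induction A rule: infinite_finite_induct) (simp_all add: lor_simps)

definition time_reflect :: "'n::finite lorentz \<Rightarrow> 'n lorentz" where
  "time_reflect x = (fst x, - snd x)"

lemma lor_eq_inner_time_reflect: "lor x y = x \<bullet> time_reflect y"
  by (simp add: lor_def time_reflect_def inner_prod_def)

lemma inner_eq_lor_time_reflect: "x \<bullet> y = lor x (time_reflect y)"
  by (simp add: lor_def time_reflect_def inner_prod_def)

lemma time_reflect_eq_0_iff [simp]: "time_reflect x = 0 \<longleftrightarrow> x = 0"
  by (simp add: time_reflect_def prod_eq_iff)

lemma lor_self: "lor x x = (norm (fst x))\<^sup>2 - (snd x)\<^sup>2"
  by (simp add: lor_def dot_square_norm power2_eq_square)

text \<open>
  This holds because a timelike direction uses up the single negative direction of the form. It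
  amounts to the Euclidean Cauchy-Schwarz inequality for the spatial components.
\<close>

lemma orthogonal_timelike_pos:
  assumes p: "lor p p < 0" and up: "lor u p = 0" and "u \<noteq> 0"
  shows "lor u u > 0"
proof (cases "fst u = 0")
  case True
  moreover have "snd p \<noteq> 0"
    using p zero_le_power2[of "norm (fst p)"] by (auto simp: lor_self)
  ultimately have "snd u = 0" using up by (simp add: lor_def)
  with True \<open>u \<noteq> 0\<close> show ?thesis by (simp add: prod_eq_iff)
next
  case False
  have n: "(norm (fst p))\<^sup>2 < (snd p)\<^sup>2" using p by (simp add: lor_self)
  have "(snd u * snd p)\<^sup>2 = (fst u \<bullet> fst p)\<^sup>2" using up by (simp add: lor_def)
  also have "\<dots> \<le> (norm (fst u) * norm (fst p))\<^sup>2"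
    using Cauchy_Schwarz_ineq2[of "fst u" "fst p"] by (metis abs_ge_zero power2_abs power_mono)
  also have "\<dots> < (norm (fst u))\<^sup>2 * (snd p)\<^sup>2"
    using n False by (simp add: power_mult_distrib)
  finally have "(snd u)\<^sup>2 * (snd p)\<^sup>2 < (norm (fst u))\<^sup>2 * (snd p)\<^sup>2"
    by (simp add: power_mult_distrib)
  then have "(snd u)\<^sup>2 < (norm (fst u))\<^sup>2" by (simp add: mult_less_cancel_right)
  then show ?thesis by (simp add: lor_self)
qed

lemma orthogonal_timelike_nonneg:
  assumes "lor p p < 0" and "lor u p = 0"
  shows "lor u u \<ge> 0"
  using orthogonal_timelike_pos[OF assms] by (cases "u = 0") (auto simp: lor_simps)

lemma orthogonal_timelike_Cauchy_Schwarz: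
  assumes p: "lor p p < 0" and u: "lor u p = 0" and v: "lor v p = 0"
  shows "(lor u v)\<^sup>2 \<le> lor u u * lor v v"
proof (cases "v = 0")
  case False
  define z where "z = lor v v *\<^sub>R u - lor u v *\<^sub>R v"
  have "lor z p = 0" using u v by (simp add: z_def lor_simps)
  then have "0 \<le> lor z z" by (rule orthogonal_timelike_nonneg[OF p])
  also have "lor z z = lor v v * (lor u u * lor v v - (lor u v)\<^sup>2)"
    by (simp add: z_def lor_simps lor_commute power2_eq_square algebra_simps)
  finally show ?thesis
    using orthogonal_timelike_pos[OF p v False] by (simp add: zero_le_mult_iff)
qed (simp add: lor_simps)

lemma lor_lightlike_timelike_nonzero:
  assumes "lightlike w" and "lor p p < 0"
  shows "lor p w \<noteq> 0"
  using orthogonal_timelike_pos[of p w] assms by (auto simp: lightlike_def lor_commute)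

lemma lightlike_snd_nonzero: "lightlike w \<Longrightarrow> snd w \<noteq> 0"
  by (auto simp: lightlike_def lor_self prod_eq_iff)

lemma lightlike_orthogonal_span_eq:
  assumes w: "lightlike w" and w': "lightlike w'" and o: "lor w w' = 0"
  shows "span {w} = span {w'}"
proof -
  define z where "z = snd w' *\<^sub>R w - snd w *\<^sub>R w'"
  have "snd z = 0" by (simp add: z_def mult.commute)
  moreover have "lor z z = 0"
    using w w' o by (simp add: z_def lightlike_def lor_simps lor_commute)
  ultimately have "z = 0" by (simp add: lor_self prod_eq_iff)
  then have eq: "snd w' *\<^sub>R w = snd w *\<^sub>R w'" by (simp add: z_def)
  have nz: "snd w \<noteq> 0" "snd w' \<noteq> 0" using w w' by (simp_all add: lightlike_snd_nonzero)
  have "w = (snd w / snd w') *\<^sub>R w'"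
    using arg_cong[OF eq, of "\<lambda>v. (1 / snd w') *\<^sub>R v"] nz by simp
  then have "span {w} = span {(snd w / snd w') *\<^sub>R w'}" by simp
  also have "\<dots> = span {w'}"
    using nz by (intro span_image_scale[of "{w'}" "\<lambda>_. snd w / snd w'", simplified]) auto
  finally show ?thesis .
qed

lemma lor_hyp_space_neg:
  assumes x: "x \<in> hyp_space" and y: "lor y y < 0" "snd y > 0"
  shows "lor x y < 0"
proof -
  have "(norm (fst x))\<^sup>2 < (snd x)\<^sup>2" "(norm (fst y))\<^sup>2 < (snd y)\<^sup>2" "snd x > 0"
    using x y by (auto simp: hyp_space_def lor_self)
  then have "norm (fst x) < snd x" "norm (fst y) < snd y"
    using y by (auto intro: power2_less_imp_less)
  then have "norm (fst x) * norm (fst y) < snd x * snd y"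
    by (intro mult_strict_mono') auto
  moreover have "fst x \<bullet> fst y \<le> norm (fst x) * norm (fst y)"
    by (rule norm_cauchy_schwarz)
  ultimately show ?thesis by (simp add: lor_def)
qed

text \<open>
  A point of the hyperboloid has negative product with the points of its own sheet and positive
  product with those of the other sheet.
\<close>

lemma hyp_spaceI:
  assumes x: "x \<in> hyp_space" and y: "lor y y = -1" and xy: "lor x y < 0"
  shows "y \<in> hyp_space"
proof -
  have "snd y \<noteq> 0"
  proof
    assume "snd y = 0"
    with y show False using zero_le_power2[of "norm (fst y)"] by (simp add: lor_self)
  qed
  moreover have "\<not> snd y < 0"
    using lor_hyp_space_neg[OF x, of "- y"] y xy by (auto simp: lor_simps)
  ultimately show ?thesis using y by (auto simp: hyp_space_def)
qed

lemma timelike_scale_hyp_space: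
  assumes "lor x x < 0"
  obtains k where "k \<noteq> 0" and "k *\<^sub>R x \<in> hyp_space"
proof -
  have s: "snd x \<noteq> 0"
  proof
    assume "snd x = 0"
    with assms zero_le_power2[of "norm (fst x)"] show False by (simp add: lor_self)
  qed
  define k where "k = sgn (snd x) / sqrt (- lor x x)"
  have "k * k * lor x x = -1" using assms s
    by (simp add: k_def sgn_if field_simps)
  moreover have "k * snd x > 0" using assms s
    by (auto simp: k_def sgn_if field_simps zero_less_mult_iff)
  ultimately have "k *\<^sub>R x \<in> hyp_space" by (simp add: hyp_space_def lor_simps)
  moreover have "k \<noteq> 0" using s assms by (auto simp: k_def sgn_if)
  ultimately show ?thesis using that by blast
qed

lemma spacelike_scale_unit:
  assumes "lor u u > 0"
  shows "spacelike_unit ((1 / sqrt (lor u u)) *\<^sub>R u)"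
  using assms by (simp add: spacelike_unit_def lor_simps)

lemma spacelike_unit_nonzero: "spacelike_unit v \<Longrightarrow> v \<noteq> 0"
  by (auto simp: spacelike_unit_def lor_simps)

lemma spacelike_unit_uminus [simp]: "spacelike_unit (- v) \<longleftrightarrow> spacelike_unit v"
  by (simp add: spacelike_unit_def lor_simps)

section \<open>Hyperplanes and their unit normals\<close>

lemma perp_plane_uminus [simp]: "perp_plane (- v) = perp_plane v"
  by (simp add: perp_plane_def lor_simps)

lemma perp_planeD: "x \<in> perp_plane v \<Longrightarrow> x \<in> hyp_space \<and> lor x x = -1 \<and> lor x v = 0 \<and> lor v x = 0"
  by (simp add: perp_plane_def hyp_space_def lor_commute)

lemma perp_plane_nonempty:
  assumes "spacelike_unit v"
  obtains p where "p \<in> perp_plane v"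
proof -
  define e where "e = (0, 1) - lor (0, 1) v *\<^sub>R v"
  have "lor e e = - 1 - (lor (0, 1) v)\<^sup>2" using assms
    by (simp add: e_def lor_simps spacelike_unit_def power2_eq_square lor_commute)
      (simp add: lor_def)
  then have "lor e e < 0" using zero_le_power2[of "lor (0, 1) v"] by linarith
  moreover have "lor e v = 0" using assms by (simp add: e_def lor_simps spacelike_unit_def)
  moreover obtain k where "k *\<^sub>R e \<in> hyp_space"
    using timelike_scale_hyp_space[OF \<open>lor e e < 0\<close>] by metis
  ultimately have "k *\<^sub>R e \<in> perp_plane v" by (simp add: perp_plane_def lor_simps)
  then show ?thesis by (rule that)
qed

text \<open>
  The complement of \<open>v\<close> is spanned by the hyperplane of \<open>v\<close>: adding a large multiple of one of
  its points makes any vector of the complement timelike. Applied to the component of \<open>v'\<close>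
  orthogonal to \<open>v\<close>, this shows that the component vanishes.
\<close>

lemma perp_plane_subset_imp:
  assumes v: "spacelike_unit v" and v': "spacelike_unit v'"
    and sub: "perp_plane v \<subseteq> perp_plane v'"
  shows "v' = v \<or> v' = - v"
proof -
  define c where "c = lor v v'"
  define r where "r = v' - c *\<^sub>R v"
  obtain p where p: "p \<in> perp_plane v" using perp_plane_nonempty[OF v] .
  have pv: "lor p v = 0" "lor p p = -1" "lor p v' = 0"
    using p sub perp_planeD by blast+
  have vv: "lor v v = 1" "lor v' v' = 1" using v v' by (auto simp: spacelike_unit_def)
  have rv: "lor r v = 0" using vv by (simp add: r_def lor_simps c_def lor_commute)
  have rp: "lor r p = 0" using pv by (simp add: r_def lor_simps lor_commute)
  have rr: "lor r r \<ge> 0" using orthogonal_timelike_nonneg[of p r] rp pv by simp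
  define k where "k = 1 + lor r r"
  define z where "z = k *\<^sub>R p + r"
  have "lor z z = lor r r - k\<^sup>2" using pv rp
    by (simp add: z_def lor_simps lor_commute power2_eq_square)
  also have "\<dots> < 0" using rr by (simp add: k_def power2_eq_square algebra_simps)
      (smt (verit) mult_nonneg_nonneg)
  finally obtain l where l: "l \<noteq> 0" "l *\<^sub>R z \<in> hyp_space" using timelike_scale_hyp_space by blast
  have "lor z v = 0" using pv rv by (simp add: z_def lor_simps)
  then have "l *\<^sub>R z \<in> perp_plane v" using l by (simp add: perp_plane_def lor_simps)
  then have "l *\<^sub>R z \<in> perp_plane v'" using sub by blast
  then have "lor z v' = 0" using l by (simp add: perp_plane_def lor_simps)
  then have "lor r v' = 0" using pv by (simp add: z_def lor_simps)
  then have "lor r r = 0" using rv by (simp add: r_def lor_simps lor_commute)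
  then have "r = 0" using orthogonal_timelike_pos[of p r] rp pv by force
  then have e: "v' = c *\<^sub>R v" by (simp add: r_def)
  then have "c * c = 1" using vv by (simp add: lor_simps)
  then have "c = 1 \<or> c = -1" by (simp add: square_eq_1_iff)
  with e show ?thesis by auto
qed

lemma unit_normalD: "unit_normal P v \<Longrightarrow> spacelike_unit v \<and> lor v v = 1 \<and> P = perp_plane v"
  by (simp add: unit_normal_def spacelike_unit_def)

lemma unit_normal_unique:
  assumes "unit_normal P v" and "unit_normal P v'"
  shows "v' = v \<or> v' = - v"
  using assms perp_plane_subset_imp[of v v'] by (simp add: unit_normal_def)

lemma unit_normal_uminus: "unit_normal P v \<Longrightarrow> unit_normal P (- v)"
  by (simp add: unit_normal_def)

lemma hyperplane_iff_unit_normal: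
  "hyperplane (P :: 'n::finite lorentz set) \<longleftrightarrow> (\<exists>v. unit_normal P v)"
proof
  assume "hyperplane P"
  then obtain V where V: "subspace V" "dim V = CARD('n)" "P = hyp_space \<inter> V" "P \<noteq> {}"
    unfolding hyperplane_def by blast
  have "dim V < DIM('n lorentz)" using V by simp
  then obtain a where a: "a \<noteq> 0" "span V \<subseteq> {x. a \<bullet> x = 0}"
    using lowdim_subset_hyperplane by blast
  have "V \<subseteq> {x. a \<bullet> x = 0}" using a span_superset by blast
  moreover have "dim {x. a \<bullet> x = 0} \<le> dim V" using V a by (simp add: dim_hyperplane)
  ultimately have Veq: "V = {x. a \<bullet> x = 0}"
    using subspace_dim_equal[OF V(1) subspace_hyperplane] by blast
  define b where "b = time_reflect a"
  have Vb: "V = {x. lor x b = 0}"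
    unfolding Veq by (auto simp: b_def inner_eq_lor_time_reflect[symmetric] inner_commute)
  obtain p where "p \<in> hyp_space" "lor b p = 0" using V Vb by (auto simp: lor_commute)
  then have pos: "lor b b > 0"
    using orthogonal_timelike_pos[of p b] a by (auto simp: hyp_space_def b_def)
  then have "unit_normal P ((1 / sqrt (lor b b)) *\<^sub>R b)"
    using spacelike_scale_unit[OF pos] V Vb
    by (auto simp: unit_normal_def perp_plane_def lor_simps)
  then show "\<exists>v. unit_normal P v" by blast
next
  assume "\<exists>v. unit_normal P v"
  then obtain v where v: "spacelike_unit v" "P = perp_plane v" by (auto simp: unit_normal_def)
  define V where "V = {x. time_reflect v \<bullet> x = 0}"
  have "subspace V" unfolding V_def by (rule subspace_hyperplane)
  moreover have "dim V = CARD('n)"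
    using spacelike_unit_nonzero[OF v(1)] by (simp add: V_def dim_hyperplane)
  moreover have "P = hyp_space \<inter> V"
    unfolding v V_def by (auto simp: perp_plane_def lor_eq_inner_time_reflect inner_commute)
  moreover have "P \<noteq> {}" using perp_plane_nonempty[OF v(1)] v(2) by blast
  ultimately show "hyperplane P" unfolding hyperplane_def by blast
qed

section \<open>Relative position of two hyperplanes\<close>

text \<open>
  Normals at a common point \<open>p\<close> lie in the positive definite complement of \<open>p\<close>. Conversely, if
  the two normals span a positive definite plane, then the component of a timelike vector
  orthogonal to that plane is still timelike, and its multiple on the upper sheet is a common
  point.
\<close>

lemma perp_planes_meet_iff:
  assumes v: "spacelike_unit v" and v': "spacelike_unit v'"
  shows "perp_plane v \<inter> perp_plane v' \<noteq> {} \<longleftrightarrow> \<bar>lor v v'\<bar> < 1 \<or> v' = v \<or> v' = - v"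
proof
  have vv: "lor v v = 1" "lor v' v' = 1" using v v' by (auto simp: spacelike_unit_def)
  define c where "c = lor v v'"
  {
    assume "perp_plane v \<inter> perp_plane v' \<noteq> {}"
    then obtain p where p: "lor p p = -1" "lor v p = 0" "lor v' p = 0"
      using perp_planeD by blast
    have le: "c\<^sup>2 \<le> 1"
      using orthogonal_timelike_Cauchy_Schwarz[of p v v'] p vv by (simp add: c_def)
    then have "\<bar>c\<bar> \<le> 1" using abs_square_le_1 by blast
    show "\<bar>lor v v'\<bar> < 1 \<or> v' = v \<or> v' = - v"
    proof (cases "\<bar>c\<bar> < 1")
      case False
      with \<open>\<bar>c\<bar> \<le> 1\<close> have c: "c = 1 \<or> c = -1" by linarith
      define r where "r = v' - c *\<^sub>R v"
      have "lor r p = 0" using p by (simp add: r_def lor_simps)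
      moreover have "lor r r = 0"
        using c vv by (auto simp: r_def lor_simps c_def[symmetric] lor_commute[of v' v])
      ultimately have "r = 0" using orthogonal_timelike_pos[of p r] p by force
      with c show ?thesis by (auto simp: r_def)
    qed (simp add: c_def)
  }
  {
    assume "\<bar>lor v v'\<bar> < 1 \<or> v' = v \<or> v' = - v"
    then consider "\<bar>c\<bar> < 1" | "v' = v" | "v' = - v" unfolding c_def by blast
    then show "perp_plane v \<inter> perp_plane v' \<noteq> {}"
    proof cases
      case 1
      then have c2: "1 - c * c > 0" using abs_square_less_1[of c] by (simp add: power2_eq_square)
      define e :: "'a lorentz" where "e = (0, 1)"
      define a where "a = (lor e v - c * lor e v') / (1 - c * c)"
      define b where "b = (lor e v' - c * lor e v) / (1 - c * c)"
      define q where "q = a *\<^sub>R v + b *\<^sub>R v'"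
      define p where "p = e - q"
      have "a + c * b = lor e v" "c * a + b = lor e v'"
      proof -
        have "a + c * b = (lor e v * (1 - c * c)) / (1 - c * c)"
          "c * a + b = (lor e v' * (1 - c * c)) / (1 - c * c)"
          unfolding a_def b_def times_divide_eq_right add_divide_distrib[symmetric]
          by (simp_all add: algebra_simps)
        with c2 show "a + c * b = lor e v" "c * a + b = lor e v'" by simp_all
      qed
      then have pv: "lor p v = 0" "lor p v' = 0"
        using vv by (simp_all add: p_def q_def lor_simps lor_commute[of v' v] c_def algebra_simps)
      then have "lor p q = 0" by (simp add: q_def lor_simps)
      then have "lor e e = lor p p + lor q q"
        by (simp add: p_def lor_simps lor_commute algebra_simps)
      moreover have "lor e e = -1" by (simp add: e_def lor_def)
      moreover have "lor q q = (a + c * b)\<^sup>2 + (1 - c * c) * b\<^sup>2" using vv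
        by (simp add: q_def lor_simps lor_commute[of v' v] c_def power2_eq_square algebra_simps)
      then have "lor q q \<ge> 0" using c2 by simp
      ultimately have "lor p p < 0" by linarith
      then obtain k where "k *\<^sub>R p \<in> hyp_space" using timelike_scale_hyp_space by metis
      then have "k *\<^sub>R p \<in> perp_plane v \<inter> perp_plane v'"
        using pv by (simp add: perp_plane_def lor_simps)
      then show ?thesis by blast
    qed (use perp_plane_nonempty[OF v] in auto)
  }
qed

lemma ideal_boundary_iff:
  assumes "unit_normal P v"
  shows "L \<in> ideal_boundary P \<longleftrightarrow> (\<exists>w. L = span {w} \<and> lightlike w \<and> lor w v = 0)"
proof -
  have "lor w v' = 0 \<longleftrightarrow> lor w v = 0" if "unit_normal P v'" for v' and w :: "'a lorentz"
    using unit_normal_unique[OF assms that] by (auto simp: lor_simps)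
  then show ?thesis using assms unfolding ideal_boundary_def by blast
qed

lemma lightlike_span_orthogonal:
  assumes "span {w} = span {w'}" and "lor w' v = 0"
  shows "lor w v = 0"
proof -
  have "w \<in> span {w'}" using assms(1) span_base[of w "{w}"] by auto
  then obtain k where "w = k *\<^sub>R w'" by (auto simp: span_singleton)
  then show ?thesis using assms(2) by (simp add: lor_simps)
qed

lemma common_ideal_points:
  assumes P: "unit_normal P v" and Q: "unit_normal Q v'"
  shows "ideal_boundary P \<inter> ideal_boundary Q =
    {span {w} | w. lightlike w \<and> lor w v = 0 \<and> lor w v' = 0}"
proof (intro set_eqI)
  fix L
  show "L \<in> ideal_boundary P \<inter> ideal_boundary Q \<longleftrightarrow>
      L \<in> {span {w} | w. lightlike w \<and> lor w v = 0 \<and> lor w v' = 0}"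
    unfolding Int_iff ideal_boundary_iff[OF P] ideal_boundary_iff[OF Q] mem_Collect_eq
    using lightlike_span_orthogonal[of _ _ v'] by blast
qed

text \<open>
  Disjoint hyperplanes have \<open>\<bar>lor v v'\<bar> \<ge> 1\<close>. In the extreme case \<open>v - lor v v' *\<^sub>R v'\<close> is
  lightlike and orthogonal to both normals; it lies in their span, so every further such vector
  is orthogonal to it and therefore parallel. Otherwise the span of the normals contains a
  timelike vector, to which no lightlike vector is orthogonal.
\<close>

lemma tangent_at_infinity_iff:
  assumes P: "unit_normal P v" and Q: "unit_normal Q v'"
  shows "tangent_at_infinity P Q \<longleftrightarrow> \<bar>lor v v'\<bar> = 1 \<and> v' \<noteq> v \<and> v' \<noteq> - v"
proof -
  have v: "spacelike_unit v" "lor v v = 1" "P = perp_plane v"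
    and v': "spacelike_unit v'" "lor v' v' = 1" "Q = perp_plane v'"
    using unit_normalD[OF P] unit_normalD[OF Q] by auto
  define c where "c = lor v v'"
  define w where "w = v - c *\<^sub>R v'"
  have ww: "lor w w = 1 - c * c" using v v'
    by (simp add: w_def lor_simps c_def[symmetric] lor_commute[of v' v])
  have wv: "lor w v = 1 - c * c" "lor w v' = 0" using v v'
    by (simp_all add: w_def lor_simps c_def[symmetric] lor_commute[of v' v])
  have disj: "P \<inter> Q = {} \<longleftrightarrow> \<bar>c\<bar> \<ge> 1 \<and> v' \<noteq> v \<and> v' \<noteq> - v"
    using perp_planes_meet_iff[OF v(1) v'(1)] v v' by (auto simp: c_def)
  show ?thesis
  proof
    assume t: "tangent_at_infinity P Q"
    then have d: "\<bar>c\<bar> \<ge> 1" "v' \<noteq> v" "v' \<noteq> - v"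
      using disj by (auto simp: tangent_at_infinity_def)
    obtain w' where w': "lightlike w'" "lor w' v = 0" "lor w' v' = 0"
      using t unfolding tangent_at_infinity_def common_ideal_points[OF P Q] by blast
    have "lor w w' = 0" using w' by (simp add: w_def lor_simps lor_commute)
    then have "\<not> lor w w < 0" using lor_lightlike_timelike_nonzero[OF w'(1)] by blast
    then have "c\<^sup>2 \<le> 1" using ww by (simp add: power2_eq_square)
    then have "\<bar>c\<bar> \<le> 1" using abs_square_le_1 by blast
    with d show "\<bar>lor v v'\<bar> = 1 \<and> v' \<noteq> v \<and> v' \<noteq> - v" by (simp add: c_def)
  next
    assume r: "\<bar>lor v v'\<bar> = 1 \<and> v' \<noteq> v \<and> v' \<noteq> - v"
    then have c: "c = 1 \<or> c = -1" by (auto simp: c_def)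
    then have "w \<noteq> 0" using r by (auto simp: w_def)
    then have w: "lightlike w" "lor w v = 0" "lor w v' = 0"
      using c ww wv by (auto simp: lightlike_def)
    have "span {w'} = span {w}" if "lightlike w'" "lor w' v = 0" "lor w' v' = 0" for w'
      using that w by (intro lightlike_orthogonal_span_eq) (simp_all add: w_def lor_simps)
    then have "ideal_boundary P \<inter> ideal_boundary Q = {span {w}}"
      unfolding common_ideal_points[OF P Q] using w by blast
    then have "\<exists>!L. L \<in> ideal_boundary P \<inter> ideal_boundary Q" by simp
    moreover have "P \<inter> Q = {}" using disj r by (simp add: c_def)
    ultimately show "tangent_at_infinity P Q" by (simp add: tangent_at_infinity_def)
  qed
qed

text \<open>
  From dimension two on, a point \<open>p\<close> of a hyperplane lies halfway between two lightlike vectors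
  \<open>p + t\<close> and \<open>p - t\<close> orthogonal to the normal, where \<open>t\<close> is a unit tangent vector of the
  hyperplane. So the ideal boundary determines the hyperplane. On the line every hyperplane is
  a point with empty ideal boundary.
\<close>

lemma ideal_boundary_subset_imp:
  assumes n: "CARD('n::finite) \<ge> 2"
    and P: "unit_normal (P :: 'n lorentz set) v" and Q: "unit_normal Q v'"
    and sub: "ideal_boundary P \<subseteq> ideal_boundary Q"
  shows "v' = v \<or> v' = - v"
proof -
  have v: "spacelike_unit v" "lor v v = 1" and v': "spacelike_unit v'"
    using unit_normalD[OF P] unit_normalD[OF Q] by auto
  have light: "lor w v' = 0" if w: "lightlike w" "lor w v = 0" for w
  proof -
    have "span {w} \<in> ideal_boundary P" unfolding ideal_boundary_iff[OF P] using w by blast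
    then have "span {w} \<in> ideal_boundary Q" using sub by blast
    then obtain w' where "span {w} = span {w'}" "lor w' v' = 0"
      unfolding ideal_boundary_iff[OF Q] by blast
    then show ?thesis by (rule lightlike_span_orthogonal)
  qed
  have "perp_plane v \<subseteq> perp_plane v'"
  proof
    fix p assume "p \<in> perp_plane v"
    then have p: "p \<in> hyp_space" "lor p p = -1" "lor p v = 0" using perp_planeD by blast+
    have "dim {time_reflect p, time_reflect v} \<le> card {time_reflect p, time_reflect v}"
      by (rule dim_le_card') simp
    also have "\<dots> \<le> 2" by (simp add: card_insert_if)
    also have "2 < DIM('n lorentz)" using n by simp
    finally obtain u where u: "u \<noteq> 0"
      "span {time_reflect p, time_reflect v} \<subseteq> {x. u \<bullet> x = 0}"
      using lowdim_subset_hyperplane by blast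
    have "time_reflect p \<in> {x. u \<bullet> x = 0}" "time_reflect v \<in> {x. u \<bullet> x = 0}"
      by (rule subsetD[OF u(2)], rule span_base, simp)+
    then have uo: "lor u p = 0" "lor u v = 0" by (simp_all add: lor_eq_inner_time_reflect)
    have pos: "lor u u > 0" using orthogonal_timelike_pos[of p u] uo u p by simp
    define t where "t = (1 / sqrt (lor u u)) *\<^sub>R u"
    have t: "lor t t = 1" "lor t p = 0" "lor t v = 0" "lor p t = 0"
      using spacelike_scale_unit[OF pos] uo
      by (auto simp: t_def spacelike_unit_def lor_simps lor_commute)
    have "lor (p + t) p \<noteq> 0" "lor (p - t) p \<noteq> 0" using t p by (simp_all add: lor_simps)
    then have "p + t \<noteq> 0" "p - t \<noteq> 0" by (metis lor_simps(9))+
    then have "lightlike (p + t)" "lightlike (p - t)"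
      using t p by (simp_all add: lightlike_def lor_simps)
    then have "lor (p + t) v' = 0" "lor (p - t) v' = 0"
      using light[of "p + t"] light[of "p - t"] t p by (simp_all add: lor_simps(1,3))
    then have "lor p v' = 0" by (simp add: lor_simps)
    with p show "p \<in> perp_plane v'" by (simp add: perp_plane_def)
  qed
  then show ?thesis using perp_plane_subset_imp v v' by blast
qed

section \<open>The Lorentzian formula for sigma\<close>

text \<open>
  Along a horocycle or a geodesic the product of two velocities is positive, which determines
  the sign of \<open>lor v v'\<close> when the coorientations coincide. Conversely the curve is found from
  its required velocity \<open>v\<close> at time \<open>0\<close>; the velocity \<open>v'\<close> at the other crossing prescribes its
  remaining data.
\<close>

lemma coincide_along_lor:
  assumes "coincide_along c v v'" and D: "\<And>t. (c has_vector_derivative D t) (at t)"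
  obtains s t where "lor v v' = lor (D s) (D t)"
proof -
  obtain s t e where e: "e \<in> {1, -1}"
    and "(c has_vector_derivative e *\<^sub>R v) (at s)" "(c has_vector_derivative e *\<^sub>R v') (at t)"
    using assms(1) unfolding coincide_along_def by blast
  then have "D s = e *\<^sub>R v" "D t = e *\<^sub>R v'"
    using D vector_derivative_unique_at by blast+
  then have "lor v v' = lor (D s) (D t)" using e by (auto simp: lor_simps)
  then show ?thesis by (rule that)
qed

lemma horosphere_line_derivative:
  "((\<lambda>t. x + t *\<^sub>R u + (t\<^sup>2 / 2) *\<^sub>R w) has_vector_derivative u + t *\<^sub>R w) (at t)"
  for x u w :: "'n::finite lorentz"
  by (auto intro!: derivative_eq_intros simp: has_vector_derivative_def fun_eq_iff algebra_simps)

lemma geodesic_derivative: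
  "((\<lambda>t. cosh t *\<^sub>R p + sinh t *\<^sub>R u) has_vector_derivative sinh t *\<^sub>R p + cosh t *\<^sub>R u) (at t)"
  for p u :: "'n::finite lorentz"
  by (auto intro!: derivative_eq_intros simp: has_vector_derivative_def fun_eq_iff algebra_simps)

lemma coincide_along_horosphere_iff:
  assumes v: "spacelike_unit v" and v': "spacelike_unit v'"
    and c: "\<bar>lor v v'\<bar> = 1" and ne: "v' \<noteq> v"
  shows "coincide_along_horosphere v v' \<longleftrightarrow> lor v v' = 1"
proof
  have vv: "lor v v = 1" "lor v' v' = 1" using v v' by (auto simp: spacelike_unit_def)
  {
    assume "coincide_along_horosphere v v'"
    then obtain w c where w: "lightlike w" "horosphere_line w c" "coincide_along c v v'"
      unfolding coincide_along_horosphere_def by blast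
    then obtain x u where u: "lor u u = 1" "lor w u = 0"
      "c = (\<lambda>t. x + t *\<^sub>R u + (t\<^sup>2 / 2) *\<^sub>R w)"
      unfolding horosphere_line_def by blast
    have D: "(c has_vector_derivative u + t *\<^sub>R w) (at t)" for t
      unfolding u(3) by (rule horosphere_line_derivative)
    obtain s t where "lor v v' = lor (u + s *\<^sub>R w) (u + t *\<^sub>R w)"
      by (rule coincide_along_lor[OF w(3) D])
    then show "lor v v' = 1" using u w by (simp add: lor_simps lor_commute lightlike_def)
  }
  {
    assume c1: "lor v v' = 1"
    define w0 where "w0 = v' - v"
    have w0: "lightlike w0" "lor w0 v = 0" "lor w0 v' = 0"
      using vv c1 ne by (simp_all add: w0_def lightlike_def lor_simps lor_commute[of v' v])
    obtain x where x: "x \<in> perp_plane v" using perp_plane_nonempty[OF v] .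
    then have x': "x \<in> hyp_space" "lor x x = -1" "lor x v = 0" using perp_planeD by blast+
    define d where "d = lor x w0"
    have d: "d \<noteq> 0" using lor_lightlike_timelike_nonzero[OF w0(1)] x' by (simp add: d_def)
    \<comment> \<open>This multiple puts \<open>x\<close> on the horosphere of \<open>w\<close>, and the velocity \<open>v + t *\<^sub>R w\<close> of the
      horocycle is \<open>v'\<close> at time \<open>t = - d\<close>.\<close>
    define w where "w = (- 1 / d) *\<^sub>R w0"
    have w: "lightlike w" "lor w v = 0" "lor w v' = 0" "lor v w = 0" "lor v' w = 0" "lor w w = 0"
      using w0 d by (simp_all add: w_def lightlike_def lor_simps lor_commute)
    have xw: "lor x w = -1" using d by (simp add: w_def lor_simps d_def)
    define y where "y = (\<lambda>t. x + t *\<^sub>R v + (t\<^sup>2 / 2) *\<^sub>R w)"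
    have "horosphere_line w y"
      unfolding horosphere_line_def y_def using x' xw w vv
      by (intro exI[of _ x] exI[of _ v]) (simp add: horosphere_def)
    have yv': "v + (- d) *\<^sub>R w = v'" using d by (simp add: w_def w0_def)
    have yy: "lor (y t) (y t) = -1" for t
      using x' xw w vv by (simp add: y_def lor_simps lor_commute power2_eq_square algebra_simps)
    have "lor x (y t) = - 1 - t\<^sup>2 / 2" for t using x' xw by (simp add: y_def lor_simps)
    moreover have "- 1 - t\<^sup>2 / 2 < 0" for t :: real
      using zero_le_power2[of t] by linarith
    ultimately have yh: "y t \<in> hyp_space" for t using hyp_spaceI[OF x'(1) yy] by metis
    have "lor (y (- d)) (v + (- d) *\<^sub>R w) = 0"
      using x' xw w vv by (simp add: y_def lor_simps lor_commute algebra_simps)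
    then have "y (- d) \<in> perp_plane v'" unfolding yv' using yh by (simp add: perp_plane_def)
    moreover have "y 0 \<in> perp_plane v" using x by (simp add: y_def)
    moreover have "(y has_vector_derivative 1 *\<^sub>R v) (at 0)"
      using horosphere_line_derivative[of x v w 0] by (simp add: y_def)
    moreover have "(y has_vector_derivative 1 *\<^sub>R v') (at (- d))"
      using horosphere_line_derivative[of x v w "- d"] yv' by (simp add: y_def)
    ultimately have "coincide_along y v v'" unfolding coincide_along_def by blast
    with \<open>horosphere_line w y\<close> w show "coincide_along_horosphere v v'"
      unfolding coincide_along_horosphere_def by blast
  }
qed

text \<open>
  The common perpendicular runs in the plane spanned by the normals, so its foot \<open>p\<close> on the first
  hyperplane is a multiple of the component of \<open>v'\<close> orthogonal to \<open>v\<close>. The foot on the second one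
  is \<open>cosh t *\<^sub>R p + sinh t *\<^sub>R v\<close>.
\<close>

lemma common_perpendicular:
  assumes v: "spacelike_unit v" and v': "spacelike_unit v'" and c: "lor v v' > 1"
  obtains p t where "p \<in> perp_plane v" "cosh t *\<^sub>R p + sinh t *\<^sub>R v \<in> perp_plane v'"
    "sinh t *\<^sub>R p + cosh t *\<^sub>R v = v'" "cosh t = lor v v'"
proof -
  have vv: "lor v v = 1" "lor v' v' = 1" using v v' by (auto simp: spacelike_unit_def)
  define c where "c = lor v v'"
  have c1: "c > 1" using c by (simp add: c_def)
  then have c2: "c * c > 1" by (simp add: less_1_mult)
  \<comment> \<open>The foot on the hyperplane of \<open>v\<close> lies in the span of the normals and is orthogonal to \<open>v\<close>.\<close>
  define r where "r = v' - c *\<^sub>R v"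
  have rv: "lor r v = 0" using vv by (simp add: r_def lor_simps c_def lor_commute)
  have rr: "lor r r = - (c * c - 1)" using vv
    by (simp add: r_def lor_simps lor_commute[of v' v] flip: c_def)
  then have "lor r r < 0" using c2 by simp
  then obtain k where k: "k \<noteq> 0" "k *\<^sub>R r \<in> hyp_space" using timelike_scale_hyp_space by blast
  define p where "p = k *\<^sub>R r"
  have p: "p \<in> hyp_space" "lor p p = -1" "lor p v = 0"
    using k rv by (auto simp: p_def lor_simps hyp_space_def)
  have "k * k * (c * c - 1) = 1" using p(2) rr by (simp add: p_def lor_simps algebra_simps)
  then have "(1 / k)\<^sup>2 = c\<^sup>2 - 1" using k by (simp add: power2_eq_square field_simps)
  then have sh2: "(sinh (arcosh c))\<^sup>2 = (1 / k)\<^sup>2" using c1 by (simp add: sinh_square_eq)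
  \<comment> \<open>The sign of \<open>k\<close> was needed to bring \<open>p\<close> to the upper sheet; time may have to run backwards.\<close>
  define t where "t = (if sinh (arcosh c) = 1 / k then arcosh c else - arcosh c)"
  have sh: "sinh t = 1 / k" using sh2 power2_eq_iff[of "sinh (arcosh c)" "1 / k"]
    by (auto simp: t_def)
  have ch: "cosh t = c" using c1 by (simp add: t_def)
  define q where "q = cosh t *\<^sub>R p + sinh t *\<^sub>R v"
  have v'_eq: "sinh t *\<^sub>R p + cosh t *\<^sub>R v = v'" using k by (simp add: sh ch p_def r_def)
  have "lor q q = - (cosh t)\<^sup>2 + (sinh t)\<^sup>2" using p vv
    by (simp add: q_def lor_simps lor_commute power2_eq_square)
  then have qq: "lor q q = -1" by (simp add: cosh_square_eq)
  have "lor p q = - cosh t" using p by (simp add: q_def lor_simps)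
  then have "q \<in> hyp_space" using hyp_spaceI[OF p(1) qq] ch c1 by simp
  moreover have "lor q (sinh t *\<^sub>R p + cosh t *\<^sub>R v) = 0" using p vv
    by (simp add: q_def lor_simps lor_commute)
  ultimately have "q \<in> perp_plane v'" by (simp add: perp_plane_def v'_eq)
  then show ?thesis
    using that[of p t] p v'_eq ch by (simp add: q_def perp_plane_def c_def)
qed

lemma coincide_along_geodesic_iff:
  assumes v: "spacelike_unit v" and v': "spacelike_unit v'" and c: "\<bar>lor v v'\<bar> > 1"
  shows "coincide_along_geodesic v v' \<longleftrightarrow> lor v v' > 1"
proof
  assume "coincide_along_geodesic v v'"
  then obtain c where g: "geodesic c" "coincide_along c v v'"
    unfolding coincide_along_geodesic_def by blast
  then obtain p u where u: "lor p p = -1" "lor u u = 1" "lor p u = 0"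
    "c = (\<lambda>t. cosh t *\<^sub>R p + sinh t *\<^sub>R u)"
    unfolding geodesic_def by (auto simp: hyp_space_def)
  have D: "(c has_vector_derivative sinh t *\<^sub>R p + cosh t *\<^sub>R u) (at t)" for t
    unfolding u(4) by (rule geodesic_derivative)
  obtain s t where "lor v v' = lor (sinh s *\<^sub>R p + cosh s *\<^sub>R u) (sinh t *\<^sub>R p + cosh t *\<^sub>R u)"
    by (rule coincide_along_lor[OF g(2) D])
  also have "\<dots> = cosh (s - t)" using u
    by (simp add: lor_simps lor_commute cosh_diff)
  finally have "lor v v' > 0" by simp
  with c show "lor v v' > 1" by linarith
next
  assume "lor v v' > 1"
  then obtain p t where p: "p \<in> perp_plane v" "cosh t *\<^sub>R p + sinh t *\<^sub>R v \<in> perp_plane v'"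
    "sinh t *\<^sub>R p + cosh t *\<^sub>R v = v'"
    using common_perpendicular[OF v v'] by metis
  define y where "y = (\<lambda>t. cosh t *\<^sub>R p + sinh t *\<^sub>R v)"
  have "geodesic y" unfolding geodesic_def y_def
    using p(1) v by (intro exI[of _ p] exI[of _ v]) (simp add: perp_plane_def spacelike_unit_def)
  moreover have "(y has_vector_derivative 1 *\<^sub>R v) (at 0)"
    using geodesic_derivative[of p v 0] by (simp add: y_def)
  moreover have "(y has_vector_derivative 1 *\<^sub>R v') (at t)"
    using geodesic_derivative[of p v t] p by (simp add: y_def)
  moreover have "y 0 \<in> perp_plane v" "y t \<in> perp_plane v'" using p by (simp_all add: y_def)
  ultimately show "coincide_along_geodesic v v'"
    unfolding coincide_along_geodesic_def coincide_along_def by blast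
qed

text \<open>
  Split points \<open>x\<close> and \<open>y\<close> of the two hyperplanes into their parts along the plane of the
  common perpendicular, which are multiples \<open>a *\<^sub>R p\<close> and \<open>b *\<^sub>R q\<close> of its feet, and the
  orthogonal rest. The rest lies in a positive definite space, and it is no larger than the
  normalization of \<open>a\<close> and \<open>b\<close> allows.
\<close>

lemma lor_perp_planes_le:
  assumes v: "spacelike_unit v" and v': "spacelike_unit v'" and c: "lor v v' > 1"
    and x: "x \<in> perp_plane v" and y: "y \<in> perp_plane v'"
  shows "lor v v' \<le> - lor x y"
proof -
  obtain p t where pt: "p \<in> perp_plane v" "cosh t *\<^sub>R p + sinh t *\<^sub>R v \<in> perp_plane v'"
    "sinh t *\<^sub>R p + cosh t *\<^sub>R v = v'" "cosh t = lor v v'"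
    using common_perpendicular[OF v v' c] .
  define q where "q = cosh t *\<^sub>R p + sinh t *\<^sub>R v"
  have q: "q \<in> hyp_space" "lor q q = -1" "lor q v' = 0"
    using perp_planeD[OF pt(2)] by (auto simp: q_def)
  have p: "p \<in> hyp_space" "lor p p = -1" "lor p v = 0" "lor v p = 0"
    using perp_planeD[OF pt(1)] by auto
  have xh: "x \<in> hyp_space" "lor x x = -1" "lor x v = 0" using perp_planeD[OF x] by auto
  have yh: "y \<in> hyp_space" "lor y y = -1" "lor y v' = 0" using perp_planeD[OF y] by auto
  have snd_pos: "snd z > 0" if "z \<in> hyp_space" for z :: "'a lorentz"
    using that by (simp add: hyp_space_def)
  have pq: "lor p q = - lor v v'" using p pt by (simp add: q_def lor_simps)
  have "cosh t * cosh t - sinh t * sinh t = 1"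
    using hyperbolic_pythagoras[of t] by (simp add: power2_eq_square)
  then have p_eq: "p = cosh t *\<^sub>R q - sinh t *\<^sub>R v'"
    unfolding q_def pt(3)[symmetric]
    by (simp add: scaleR_add_right algebra_simps flip: scaleR_add_left scaleR_diff_left)
  define a where "a = - lor x p"
  define b where "b = - lor y q"
  have ab: "a > 0" "b > 0"
    using lor_hyp_space_neg[OF xh(1), of p] lor_hyp_space_neg[OF yh(1), of q] p q snd_pos
    by (auto simp: a_def b_def)
  define x' where "x' = x - a *\<^sub>R p"
  define y' where "y' = y - b *\<^sub>R q"
  have x'p: "lor x' p = 0" using p by (simp add: x'_def lor_simps a_def)
  have x'v: "lor x' v = 0" using p xh by (simp add: x'_def lor_simps)
  have x'q: "lor x' q = 0" using x'p x'v by (simp add: q_def lor_simps)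
  have y'q: "lor y' q = 0" using q by (simp add: y'_def lor_simps b_def)
  have y'v: "lor y' v' = 0" using q yh by (simp add: y'_def lor_simps)
  have y'p: "lor y' p = 0" using y'q y'v by (subst p_eq) (simp add: lor_simps)
  have xe: "x = a *\<^sub>R p + x'" and ye: "y = b *\<^sub>R q + y'" by (simp_all add: x'_def y'_def)
  have "lor x x = - a\<^sup>2 + lor x' x'"
    using p x'p by (subst xe, subst xe) (simp add: lor_simps lor_commute power2_eq_square)
  then have x'x': "lor x' x' = a\<^sup>2 - 1" using xh by simp
  have "lor y y = - b\<^sup>2 + lor y' y'"
    using q y'q by (subst ye, subst ye) (simp add: lor_simps lor_commute power2_eq_square)
  then have y'y': "lor y' y' = b\<^sup>2 - 1" using yh by simp
  have xy: "lor x y = - (a * b * lor v v') + lor x' y'"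
    using pq x'q y'p by (subst xe, subst ye) (simp add: lor_simps lor_commute)
  have "lor p p < 0" using p by simp
  have ab1: "a\<^sup>2 \<ge> 1" "b\<^sup>2 \<ge> 1"
    using orthogonal_timelike_nonneg[OF \<open>lor p p < 0\<close>] x'p y'p x'x' y'y' by fastforce+
  then have "a \<ge> 1" "b \<ge> 1" using ab abs_square_less_1[of a] abs_square_less_1[of b] by linarith+
  then have ab2: "a * b \<ge> 1" by (metis mult_mono' mult.right_neutral zero_le_one)
  have "(lor x' y')\<^sup>2 \<le> (a\<^sup>2 - 1) * (b\<^sup>2 - 1)"
    using orthogonal_timelike_Cauchy_Schwarz[OF \<open>lor p p < 0\<close> x'p y'p] x'x' y'y' by simp
  also have "\<dots> \<le> (a * b - 1)\<^sup>2"
    using zero_le_power2[of "a - b"] by (simp add: power2_eq_square algebra_simps)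
  finally have "lor x' y' \<le> a * b - 1" using ab2 power2_le_imp_le[of "lor x' y'" "a * b - 1"] by simp
  also have "\<dots> \<le> (a * b - 1) * lor v v'"
    using ab2 c mult_left_mono[of 1 "lor v v'" "a * b - 1"] by simp
  finally show ?thesis using xy by (simp add: algebra_simps)
qed

lemma hset_dist_perp_planes:
  assumes v: "spacelike_unit v" and v': "spacelike_unit v'" and c: "\<bar>lor v v'\<bar> > 1"
  shows "hset_dist (perp_plane v) (perp_plane v') = arcosh \<bar>lor v v'\<bar>"
proof -
  have main: "hset_dist (perp_plane v) (perp_plane z) = arcosh (lor v z)"
    if z: "spacelike_unit z" and c: "lor v z > 1" for z
  proof -
    obtain p t where pt: "p \<in> perp_plane v" "cosh t *\<^sub>R p + sinh t *\<^sub>R v \<in> perp_plane z"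
      "cosh t = lor v z"
      using common_perpendicular[OF v z c] by metis
    have "hdist p (cosh t *\<^sub>R p + sinh t *\<^sub>R v) = arcosh (lor v z)"
      using perp_planeD[OF pt(1)] pt(3) by (simp add: hdist_def lor_simps)
    then have "arcosh (lor v z) \<in> (\<lambda>(x, y). hdist x y) ` (perp_plane v \<times> perp_plane z)"
      using pt by force
    moreover have "arcosh (lor v z) \<le> hdist x y"
      if "x \<in> perp_plane v" "y \<in> perp_plane z" for x y
    proof -
      have "lor v z \<le> - lor x y" using lor_perp_planes_le[OF v z c that] .
      then show ?thesis using c unfolding hdist_def
        by (metis arcosh_real_strict_mono dual_order.order_iff_strict less_imp_le)
    qed
    ultimately show ?thesis unfolding hset_dist_def by (intro cInf_eq_minimum) auto
  qed
  show ?thesis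
  proof (cases "lor v v' > 1")
    case False
    then have "lor v (- v') > 1" using c by (simp add: lor_simps)
    then show ?thesis using main[of "- v'"] v' False c by (simp add: lor_simps)
  qed (use main v' in simp)
qed

text \<open>
  For hyperplanes tangent at infinity \<open>lor v v'\<close> is \<open>1\<close> or \<open>- 1\<close>. In the other branches of the
  definition the half-argument formula for the cosine or the hyperbolic cosine turns the value
  into a linear expression in \<open>lor v v'\<close>.
\<close>

lemma coor_sigma_eq:
  assumes v: "spacelike_unit v" and v': "spacelike_unit v'"
  shows "coor_sigma v v' = (lor v v' - 1) / 2"
proof -
  have vv: "lor v v = 1" "lor v' v' = 1" using v v' by (auto simp: spacelike_unit_def)
  define c where "c = lor v v'"
  have tan: "tangent_at_infinity (perp_plane v) (perp_plane v') \<longleftrightarrow>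
      \<bar>c\<bar> = 1 \<and> v' \<noteq> v \<and> v' \<noteq> - v"
    unfolding c_def using v v' by (intro tangent_at_infinity_iff) (simp_all add: unit_normal_def)
  note meet = perp_planes_meet_iff[OF v v', folded c_def]
  have same: "\<bar>c\<bar> = 1" if "v' = v \<or> v' = - v" using that vv by (auto simp: c_def lor_simps)
  have sinh_half: "(sinh (d / 2))\<^sup>2 = (cosh d - 1) / 2"
    and cosh_half: "(cosh (d / 2))\<^sup>2 = (cosh d + 1) / 2" for d :: real
    using cosh_double[of "d / 2"] cosh_square_eq[of "d / 2"] by simp_all
  consider (meet) "\<bar>c\<bar> < 1 \<or> v' = v \<or> v' = - v" | (tangent) "\<bar>c\<bar> = 1" "v' \<noteq> v" "v' \<noteq> - v"
    | (apart) "\<bar>c\<bar> > 1" "v' \<noteq> v" "v' \<noteq> - v" by linarith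
  then show ?thesis
  proof cases
    case meet
    then have "\<bar>c\<bar> \<le> 1" using same by fastforce
    then have "cos (2 * (arccos c / 2)) = c" by (simp add: abs_le_iff)
    then have "- (sin (arccos c / 2))\<^sup>2 = (c - 1) / 2" unfolding cos_double_sin by simp
    then show ?thesis using meet \<open>perp_plane v \<inter> perp_plane v' \<noteq> {} \<longleftrightarrow> _\<close>
      by (simp add: coor_sigma_def Let_def c_def)
  next
    case tangent
    then have "coor_sigma v v' = (if c = 1 then 0 else -1)"
      using tan meet coincide_along_horosphere_iff[OF v v']
      by (simp add: coor_sigma_def Let_def c_def)
    then show ?thesis using tangent by (auto simp: c_def)
  next
    case apart
    then have "coor_sigma v v' = (if c > 1 then (sinh (arcosh \<bar>c\<bar> / 2))\<^sup>2
        else - (cosh (arcosh \<bar>c\<bar> / 2))\<^sup>2)"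
      using tan meet coincide_along_geodesic_iff[OF v v'] hset_dist_perp_planes[OF v v']
      by (simp add: coor_sigma_def Let_def c_def)
    then show ?thesis using apart
      by (auto simp: c_def[symmetric] sinh_half cosh_half abs_if field_simps)
  qed
qed

section \<open>Linear relations\<close>

lemma det_eq_0_iff_kernel:
  fixes A :: "real^'m^'m"
  shows "det A = 0 \<longleftrightarrow> (\<exists>x. x \<noteq> 0 \<and> A *v x = 0)"
  using invertible_det_nz[of A] invertible_left_inverse[of A] matrix_left_invertible_ker[of A]
  by blast

lemma nontrivial_relation:
  fixes a :: "'m::finite \<Rightarrow> 'e::euclidean_space"
  assumes orth: "\<And>i t. t \<in> T \<Longrightarrow> a i \<bullet> t = 0"
    and dim: "DIM('e) < CARD('m) + dim T"
  obtains x :: "real^'m" where "x \<noteq> 0" "(\<Sum>i\<in>UNIV. x $ i *\<^sub>R a i) = 0"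
proof -
  define L where "L = (\<lambda>x :: real^'m. \<Sum>i\<in>UNIV. x $ i *\<^sub>R a i)"
  have lin: "linear L" unfolding L_def
    by (rule linearI) (simp_all add: sum.distrib scaleR_left_distrib scaleR_right.sum)
  have "\<not> inj L"
  proof
    assume "inj L"
    then have "dim (range L) = CARD('m)" using dim_image_eq[OF lin, of UNIV] by simp
    moreover have "dim (range L \<union> T) = dim (range L) + dim T"
      by (rule dim_orthogonal_sum) (auto simp: L_def inner_sum_left orth)
    ultimately show False using dim dim_subset_UNIV[of "range L \<union> T"] by simp
  qed
  then show ?thesis using that linear_injective_0[OF lin] by (auto simp: L_def)
qed

text \<open>
  The relation makes one of the vectors redundant, so their span leaves room for two orthogonal
  directions and not just one.
\<close>

lemma orthogonal_pair_of_relation: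
  fixes a :: "'m::finite \<Rightarrow> 'e::euclidean_space" and x :: "real^'m"
  assumes x: "x \<noteq> 0" and rel: "(\<Sum>i\<in>UNIV. x $ i *\<^sub>R a i) = 0" and dim: "CARD('m) < DIM('e)"
  obtains b b' where "b \<noteq> 0" "b' \<noteq> 0" "b \<bullet> b' = 0" "\<And>i. a i \<bullet> b = 0" "\<And>i. a i \<bullet> b' = 0"
proof -
  obtain k where k: "x $ k \<noteq> 0" using x by (auto simp: vec_eq_iff)
  define B where "B = a ` (UNIV - {k})"
  have "x $ k *\<^sub>R a k = - (\<Sum>i\<in>UNIV - {k}. x $ i *\<^sub>R a i)"
    using rel by (simp add: sum.remove[of UNIV k] eq_neg_iff_add_eq_0)
  then have "a k = (1 / x $ k) *\<^sub>R (- (\<Sum>i\<in>UNIV - {k}. x $ i *\<^sub>R a i))"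
    using k by (metis divide_self_if eq_vector_fraction_iff scaleR_one times_divide_eq_left mult_1)
  moreover have "(\<Sum>i\<in>UNIV - {k}. x $ i *\<^sub>R a i) \<in> span B"
    by (intro span_sum span_scale span_base) (auto simp: B_def)
  ultimately have "a k \<in> span B" by (metis span_neg span_scale)
  then have aB: "a i \<in> span B" for i by (cases "i = k") (auto simp: B_def intro: span_base)
  have "card B \<le> CARD('m) - 1"
    unfolding B_def using card_image_le[of "UNIV - {k}" a] by (simp add: card_Diff_singleton)
  moreover have "CARD('m) > 0" by simp
  moreover have "dim B \<le> card B" by (rule dim_le_card') (simp add: B_def)
  ultimately have dB: "dim B + 1 < DIM('e)" using dim by linarith
  then obtain b where b: "b \<noteq> 0" "\<And>y. y \<in> span B \<Longrightarrow> orthogonal b y"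
    using orthogonal_to_subspace_exists[of B] by auto
  have "dim (insert b B) < DIM('e)" using dB by (simp add: dim_insert)
  then obtain b' where b': "b' \<noteq> 0" "\<And>y. y \<in> span (insert b B) \<Longrightarrow> orthogonal b' y"
    using orthogonal_to_subspace_exists by blast
  have "b \<bullet> b' = 0" using b'(2)[of b] by (simp add: span_base orthogonal_def inner_commute)
  moreover have "a i \<bullet> b = 0" for i
    using b(2)[OF aB] by (simp add: orthogonal_def inner_commute)
  moreover have "a i \<in> span (insert b B)" for i
    using aB span_mono[of B "insert b B"] by blast
  then have "a i \<bullet> b' = 0" for i
    using b'(2)[of "a i"] by (simp add: orthogonal_def inner_commute)
  ultimately show ?thesis using that b b' by blast
qed

section \<open>Singular sigma matrices\<close>

text \<open>
  Since \<open>lor\<close> is bilinear, a kernel vector \<open>x\<close> of the matrix amounts to a combination of the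
  normals whose product with each of them equals its coefficient sum.
\<close>

lemma det_coor_sigma_eq_0_iff:
  fixes v :: "'m::finite \<Rightarrow> 'n::finite lorentz"
  assumes v: "\<And>i. spacelike_unit (v i)"
  shows "det (\<chi> i j. coor_sigma (v i) (v j)) = 0 \<longleftrightarrow>
    (\<exists>x :: real^'m. x \<noteq> 0 \<and> (\<forall>i. lor (v i) (\<Sum>j\<in>UNIV. x $ j *\<^sub>R v j) = (\<Sum>j\<in>UNIV. x $ j)))"
proof -
  define A where "A = (\<chi> i j. coor_sigma (v i) (v j))"
  have Ax: "(A *v x) $ i = (lor (v i) (\<Sum>j\<in>UNIV. x $ j *\<^sub>R v j) - (\<Sum>j\<in>UNIV. x $ j)) / 2"
    for x :: "real^'m" and i
    by (simp add: A_def matrix_vector_mult_def coor_sigma_eq[OF v v] lor_sum_right lor_simps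
        sum_divide_distrib algebra_simps flip: sum_subtractf)
  have "A *v x = 0 \<longleftrightarrow>
      (\<forall>i. lor (v i) (\<Sum>j\<in>UNIV. x $ j *\<^sub>R v j) = (\<Sum>j\<in>UNIV. x $ j))" for x
    unfolding vec_eq_iff Ax by simp
  then show ?thesis using det_eq_0_iff_kernel[of A] by (simp add: A_def)
qed

lemma extended_relation_iff:
  "(\<Sum>i\<in>UNIV. x $ i *\<^sub>R (f i, 1 :: real)) = 0 \<longleftrightarrow>
    (\<Sum>i\<in>UNIV. x $ i *\<^sub>R f i) = 0 \<and> (\<Sum>i\<in>UNIV. x $ i) = 0"
  by (simp add: prod_eq_iff fst_sum snd_sum)

text \<open>
  Translating the normals by a common tangent normal \<open>z\<close> moves them into the complement of \<open>z\<close>,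
  which is too small for them to be independent.
\<close>

lemma tangent_imp_singular:
  fixes v :: "'m::finite \<Rightarrow> 'n::finite lorentz"
  assumes card: "CARD('m) = CARD('n) + 1"
    and z: "spacelike_unit z" and vz: "\<And>i. lor (v i) z = 1"
  shows "\<exists>x :: real^'m. x \<noteq> 0 \<and>
    (\<forall>i. lor (v i) (\<Sum>j\<in>UNIV. x $ j *\<^sub>R v j) = (\<Sum>j\<in>UNIV. x $ j))"
proof -
  have orth: "(v i - z) \<bullet> t = 0" if "t \<in> {time_reflect z}" for i t
    using that vz z lor_eq_inner_time_reflect[of "v i - z" z]
    by (simp add: lor_simps spacelike_unit_def)
  have "dim {time_reflect z} = 1" using spacelike_unit_nonzero[OF z] by (simp add: dim_singleton)
  then have "DIM('n lorentz) < CARD('m) + dim {time_reflect z}" using card by simp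
  from nontrivial_relation[of "{time_reflect z}" "\<lambda>i. v i - z", OF orth this]
  obtain x :: "real^'m" where x: "x \<noteq> 0" "(\<Sum>i\<in>UNIV. x $ i *\<^sub>R (v i - z)) = 0" by blast
  then have "(\<Sum>i\<in>UNIV. x $ i *\<^sub>R v i) = (\<Sum>i\<in>UNIV. x $ i) *\<^sub>R z"
    by (simp add: scaleR_diff_right sum_subtractf scaleR_left.sum)
  then show ?thesis using x vz by (intro exI[of _ x]) (simp add: lor_simps)
qed

text \<open>
  Normals orthogonal to a lightlike \<open>w\<close> matter only modulo \<open>w\<close>, since \<open>w\<close> is itself orthogonal
  to all of them. The map \<open>q\<close> divides out \<open>w\<close> and takes the complement of \<open>w\<close> to the Euclidean
  complement of \<open>fst w\<close>, so that one dimension is left for the condition on the coefficient sum.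
\<close>

lemma ideal_point_imp_singular:
  fixes v :: "'m::finite \<Rightarrow> 'n::finite lorentz"
  assumes card: "CARD('m) = CARD('n) + 1"
    and w: "lightlike w" and vw: "\<And>i. lor (v i) w = 0"
  shows "\<exists>x :: real^'m. x \<noteq> 0 \<and>
    (\<forall>i. lor (v i) (\<Sum>j\<in>UNIV. x $ j *\<^sub>R v j) = (\<Sum>j\<in>UNIV. x $ j))"
proof -
  have sw: "snd w \<noteq> 0" using lightlike_snd_nonzero[OF w] .
  have fw: "fst w \<bullet> fst w = snd w * snd w" using w by (simp add: lightlike_def lor_def)
  then have fw0: "fst w \<noteq> 0" using sw by auto
  define q where "q = (\<lambda>y :: 'n lorentz. fst y - (snd y / snd w) *\<^sub>R fst w)"
  have lin: "linear q" unfolding q_def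
    by (rule linearI) (simp_all add: algebra_simps add_divide_distrib)
  have orth: "(q (v i), 1 :: real) \<bullet> t = 0" if "t \<in> {(fst w, 0)}" for i t
  proof -
    have "fst (v i) \<bullet> fst w = snd (v i) * snd w" using vw[of i] by (simp add: lor_def)
    then have "q (v i) \<bullet> fst w = 0" using sw by (simp add: q_def inner_diff_left fw)
    then show ?thesis using that by simp
  qed
  have "dim {(fst w, 0 :: real)} = 1" using fw0 by (simp add: dim_singleton zero_prod_def)
  then have "DIM((real^'n) \<times> real) < CARD('m) + dim {(fst w, 0 :: real)}" using card by simp
  from nontrivial_relation[of "{(fst w, 0)}" "\<lambda>i. (q (v i), 1 :: real)", OF orth this]
  obtain x :: "real^'m" where x: "x \<noteq> 0" "(\<Sum>i\<in>UNIV. x $ i *\<^sub>R (q (v i), 1 :: real)) = 0" by blast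
  define y where "y = (\<Sum>i\<in>UNIV. x $ i *\<^sub>R v i)"
  have "q y = (\<Sum>i\<in>UNIV. x $ i *\<^sub>R q (v i))" unfolding y_def
    by (simp add: linear_sum[OF lin] linear_cmul[OF lin])
  then have qy: "q y = 0" and s: "(\<Sum>i\<in>UNIV. x $ i) = 0"
    using x(2) unfolding extended_relation_iff by simp_all
  have "y = (snd y / snd w) *\<^sub>R w" using qy sw by (simp add: q_def prod_eq_iff)
  then have "lor (v i) y = 0" for i using vw[of i] by (metis lor_simps(6) mult_zero_right)
  then show ?thesis using x s by (intro exI[of _ x]) (simp add: y_def)
qed

text \<open>
  Two independent linear conditions on the extended normals \<open>(v i, 1)\<close> give a relation between
  the normals with coefficient sum zero.
\<close>

lemma inclined_imp_singular:
  fixes v :: "'m::finite \<Rightarrow> 'n::finite lorentz"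
  assumes card: "CARD('m) = CARD('n) + 1"
    and u: "spacelike_unit u" and z: "spacelike_unit z" and ne: "z \<noteq> u" "z \<noteq> - u"
    and vu: "\<And>i. lor (v i) u = 0" and vz: "\<And>i. lor (v i) z = l"
  shows "\<exists>x :: real^'m. x \<noteq> 0 \<and>
    (\<forall>i. lor (v i) (\<Sum>j\<in>UNIV. x $ j *\<^sub>R v j) = (\<Sum>j\<in>UNIV. x $ j))"
proof -
  define T where "T = {(time_reflect z, - l), (time_reflect u, 0)}"
  have orth: "(v i, 1 :: real) \<bullet> t = 0" if "t \<in> T" for i t
    using that vu vz by (auto simp: T_def simp flip: lor_eq_inner_time_reflect)
  have "(time_reflect z, - l) \<notin> span {(time_reflect u, 0)}"
  proof
    assume "(time_reflect z, - l) \<in> span {(time_reflect u, 0)}"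
    then obtain k where "time_reflect z = k *\<^sub>R time_reflect u" by (auto simp: span_singleton)
    then have zk: "z = k *\<^sub>R u" by (simp add: time_reflect_def prod_eq_iff)
    then have "k * k = 1" using u z by (simp add: spacelike_unit_def lor_simps)
    then have "k = 1 \<or> k = -1" by (simp add: square_eq_1_iff)
    then show False using zk ne by auto
  qed
  moreover have "time_reflect u \<noteq> 0" using spacelike_unit_nonzero[OF u] by simp
  then have "(time_reflect u, 0 :: real) \<noteq> 0" by (metis fst_conv fst_zero)
  ultimately have "dim T = 2" by (simp add: T_def dim_insert dim_singleton)
  then have "DIM('n lorentz \<times> real) < CARD('m) + dim T" using card by simp
  from nontrivial_relation[of T "\<lambda>i. (v i, 1 :: real)", OF orth this]
  obtain x :: "real^'m" where x: "x \<noteq> 0" "(\<Sum>i\<in>UNIV. x $ i *\<^sub>R (v i, 1 :: real)) = 0" by blast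
  then show ?thesis unfolding extended_relation_iff by (intro exI[of _ x]) (simp add: lor_simps)
qed

text \<open>
  The discriminant \<open>D\<close> of the form on the plane of \<open>u\<close> and \<open>z\<close> decides. For \<open>D \<ge> 0\<close> the quadratic
  equation for a lightlike vector is solvable. For \<open>D < 0\<close> the plane is definite, and it cannot
  be negative definite, because the complement of a timelike vector is positive.
\<close>

lemma plane_lightlike_or_positive:
  assumes "u \<noteq> 0" and ind: "\<And>k. z \<noteq> k *\<^sub>R u"
  obtains a b where "lightlike (a *\<^sub>R u + b *\<^sub>R z)"
  | "lor u u > 0" "lor z z > 0"
proof (cases "\<exists>a b. lightlike (a *\<^sub>R u + b *\<^sub>R z)")
  case False
  define g where "g = lor u z"
  define D where "D = g\<^sup>2 - lor u u * lor z z"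
  have nl: "\<not> lightlike (a *\<^sub>R u + b *\<^sub>R z)" for a b using False by blast
  have uu: "lor u u \<noteq> 0" using nl[of 1 0] assms by (simp add: lightlike_def)
  have "D < 0"
  proof (rule ccontr)
    assume "\<not> D < 0"
    then have sD: "(sqrt D)\<^sup>2 = D" by simp
    define k where "k = (sqrt D - g) / lor u u"
    have ku: "k * lor u u + g = sqrt D" using uu by (simp add: k_def)
    have "lor u u * lor (k *\<^sub>R u + 1 *\<^sub>R z) (k *\<^sub>R u + 1 *\<^sub>R z) = (k * lor u u + g)\<^sup>2 - D"
      by (simp add: lor_simps lor_commute[of z u] D_def power2_eq_square algebra_simps flip: g_def)
    also have "\<dots> = 0" using ku sD by simp
    finally have "lor (k *\<^sub>R u + 1 *\<^sub>R z) (k *\<^sub>R u + 1 *\<^sub>R z) = 0" using uu by simp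
    moreover have "k *\<^sub>R u + 1 *\<^sub>R z \<noteq> 0"
      using ind[of "- k"] by (auto simp: add_eq_0_iff)
    ultimately show False using nl[of k 1] by (simp add: lightlike_def)
  qed
  have "lor u u > 0"
  proof (rule ccontr)
    assume "\<not> lor u u > 0"
    then have neg: "lor u u < 0" using uu by simp
    define r where "r = lor u u *\<^sub>R z - g *\<^sub>R u"
    have "lor r u = 0" by (simp add: r_def lor_simps g_def lor_commute)
    then have "lor r r \<ge> 0" by (rule orthogonal_timelike_nonneg[OF neg])
    moreover have "lor r r = lor u u * - D"
      by (simp add: r_def lor_simps lor_commute[of z u] D_def power2_eq_square algebra_simps
          flip: g_def)
    ultimately show False using mult_neg_neg[OF neg \<open>D < 0\<close>] by simp
  qed
  moreover have "lor u u * lor z z > 0"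
    using \<open>D < 0\<close> zero_le_power2[of g] unfolding D_def by linarith
  ultimately show ?thesis using that(2) by (simp add: zero_less_mult_iff)
qed (use that in blast)

text \<open>
  All solutions \<open>\<beta> + r *\<^sub>R u\<close> of the same affine conditions are available. For spacelike \<open>u\<close> they
  become arbitrarily long, so that after normalization their common product with the normals
  is smaller than \<open>1\<close>. For timelike \<open>u\<close> their squared length decreases from a value that is at least \<open>1\<close> by the Cauchy-Schwarz
  inequality in the complement of \<open>u\<close>, and it passes through \<open>1\<close>.
\<close>

lemma affine_family_alternatives:
  fixes v :: "'m \<Rightarrow> 'n::finite lorentz"
  assumes v: "\<And>i. spacelike_unit (v i)"
    and u: "u \<noteq> 0" "\<And>i. lor (v i) u = 0" and \<beta>: "\<And>i. lor (v i) \<beta> = 1"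
  shows "(\<exists>z. spacelike_unit z \<and> (\<forall>i. \<bar>lor (v i) z\<bar> = 1)) \<or>
    (\<exists>w. lightlike w \<and> (\<forall>i. lor (v i) w = 0)) \<or>
    (\<exists>u z l. spacelike_unit u \<and> spacelike_unit z \<and> z \<noteq> u \<and> z \<noteq> - u \<and> 0 \<le> l \<and> l < 1 \<and>
      (\<forall>i. lor (v i) u = 0 \<and> \<bar>lor (v i) z\<bar> = l))"
proof -
  consider "lor u u = 0" | "lor u u > 0" | "lor u u < 0" by linarith
  then show ?thesis
  proof cases
    case 1
    then have "lightlike u" using u(1) by (simp add: lightlike_def)
    then show ?thesis using u(2) by blast
  next
    case 2
    define t where "t = (1 / sqrt (lor u u)) *\<^sub>R u"
    have t: "spacelike_unit t" "lor t t = 1" "lor (v i) t = 0" for i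
      using spacelike_scale_unit[OF 2] u by (auto simp: t_def spacelike_unit_def lor_simps)
    \<comment> \<open>Large enough for \<open>\<beta> + r *\<^sub>R t\<close> to have squared length above \<open>1\<close>.\<close>
    define r where "r = \<bar>lor \<beta> \<beta>\<bar> + 2 * \<bar>lor \<beta> t\<bar> + 2"
    define y where "y = \<beta> + r *\<^sub>R t"
    define N where "N = lor y y"
    have yv: "lor (v i) y = 1" for i using t \<beta> by (simp add: y_def lor_simps)
    have "r * (r + 2 * lor \<beta> t) \<ge> r * 2"
      by (rule mult_left_mono) (auto simp: r_def)
    moreover have "N = lor \<beta> \<beta> + r * (r + 2 * lor \<beta> t)"
      using t by (simp add: N_def y_def lor_simps lor_commute[of t \<beta>] algebra_simps)
    moreover have "r * 2 + lor \<beta> \<beta> > 1" by (auto simp: r_def)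
    ultimately have N: "N > 1" by linarith
    define z where "z = (1 / sqrt N) *\<^sub>R y"
    have z: "spacelike_unit z" using spacelike_scale_unit[of y] N by (simp add: z_def N_def)
    have zv: "lor (v i) z = 1 / sqrt N" for i using yv by (simp add: z_def lor_simps)
    have l: "1 / sqrt N > 0" "1 / sqrt N < 1" using N by simp_all
    \<comment> \<open>Here and below, \<open>undefined\<close> is just some index.\<close>
    have "z \<noteq> t" "z \<noteq> - t" using zv[of undefined] t(3)[of undefined] l by (auto simp: lor_simps)
    then show ?thesis using z zv t l
      by (intro disjI2 exI[of _ t] exI[of _ z] exI[of _ "1 / sqrt N"]) auto
  next
    case 3
    define y where "y = \<beta> - (lor \<beta> u / lor u u) *\<^sub>R u"
    have yv: "lor (v i) y = 1" for i using u \<beta> by (simp add: y_def lor_simps)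
    have yu: "lor y u = 0" using 3 by (simp add: y_def lor_simps)
    have "1 \<le> lor y y"
      using orthogonal_timelike_Cauchy_Schwarz[OF 3 u(2) yu, of undefined] yv v
      by (simp add: spacelike_unit_def)
    define r where "r = sqrt ((lor y y - 1) / (- lor u u))"
    have "r * r = (lor y y - 1) / (- lor u u)" unfolding r_def
      using \<open>1 \<le> lor y y\<close> 3
      by (intro real_sqrt_mult_self[THEN trans] abs_of_nonneg divide_nonneg_pos) simp_all
    then have rr: "r * (r * lor u u) = 1 - lor y y" using 3 by (simp add: field_simps)
    define z where "z = y + r *\<^sub>R u"
    have "spacelike_unit z" using yu rr
      by (simp add: spacelike_unit_def z_def lor_simps lor_commute[of u y])
    moreover have "lor (v i) z = 1" for i using yv u by (simp add: z_def lor_simps)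
    ultimately show ?thesis by (intro disjI1 exI[of _ z]) simp
  qed
qed

text \<open>
  With \<open>w\<close> and \<open>s\<close> the combination of the normals and its coefficient sum, \<open>lor w w = s\<^sup>2\<close>. So \<open>w\<close>
  is spacelike and gives the tangent hyperplane, or it is lightlike and gives the ideal point,
  or it vanishes together with \<open>s\<close>. In the last case the extended normals \<open>(v i, 1)\<close> are
  dependent, and at least two independent vectors are orthogonal to them.
\<close>

lemma singular_imp_alternatives:
  fixes v :: "'m::finite \<Rightarrow> 'n::finite lorentz" and x :: "real^'m"
  assumes card: "CARD('m) = CARD('n) + 1" and v: "\<And>i. spacelike_unit (v i)"
    and x: "x \<noteq> 0"
    and eq: "\<And>i. lor (v i) (\<Sum>j\<in>UNIV. x $ j *\<^sub>R v j) = (\<Sum>j\<in>UNIV. x $ j)"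
  shows "(\<exists>z. spacelike_unit z \<and> (\<forall>i. \<bar>lor (v i) z\<bar> = 1)) \<or>
    (\<exists>w. lightlike w \<and> (\<forall>i. lor (v i) w = 0)) \<or>
    (\<exists>u z l. spacelike_unit u \<and> spacelike_unit z \<and> z \<noteq> u \<and> z \<noteq> - u \<and> 0 \<le> l \<and> l < 1 \<and>
      (\<forall>i. lor (v i) u = 0 \<and> \<bar>lor (v i) z\<bar> = l))" (is "?tangent \<or> ?ideal \<or> ?inclined")
proof -
  define w where "w = (\<Sum>j\<in>UNIV. x $ j *\<^sub>R v j)"
  define s where "s = (\<Sum>j\<in>UNIV. x $ j)"
  have vw: "lor (v i) w = s" for i using eq by (simp add: w_def s_def)
  have "lor w w = (\<Sum>j\<in>UNIV. x $ j * lor (v j) w)"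
    by (subst w_def) (simp add: lor_sum_left lor_simps)
  also have "\<dots> = s\<^sup>2" by (simp add: vw s_def power2_eq_square sum_distrib_right)
  finally have ww: "lor w w = s\<^sup>2" .
  consider "s \<noteq> 0" | "s = 0" "w \<noteq> 0" | "s = 0" "w = 0" by blast
  then show ?thesis
  proof cases
    case 1
    then have "spacelike_unit ((1 / s) *\<^sub>R w)"
      by (simp add: spacelike_unit_def lor_simps ww power2_eq_square)
    moreover have "lor (v i) ((1 / s) *\<^sub>R w) = 1" for i using 1 by (simp add: lor_simps vw)
    ultimately have ?tangent by (intro exI[of _ "(1 / s) *\<^sub>R w"]) simp
    then show ?thesis by blast
  next
    case 2
    then have "lightlike w" using ww by (simp add: lightlike_def)
    then show ?thesis using vw 2 by blast
  next
    case 3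
    then have rel: "(\<Sum>i\<in>UNIV. x $ i *\<^sub>R (v i, 1 :: real)) = 0"
      unfolding extended_relation_iff by (simp add: w_def s_def)
    have "CARD('m) < DIM('n lorentz \<times> real)" using card by simp
    from orthogonal_pair_of_relation[OF x rel this]
    obtain b b' :: "'n lorentz \<times> real" where b: "b \<noteq> 0" "b' \<noteq> 0" "b \<bullet> b' = 0"
      "\<And>i. (v i, 1) \<bullet> b = 0" "\<And>i. (v i, 1) \<bullet> b' = 0" by blast
    define f where "f = (\<lambda>y :: 'n lorentz \<times> real. time_reflect (fst y))"
    have f: "lor (v i) (f y) = - snd y" if "(v i, 1) \<bullet> y = 0" for y i
      using that by (cases y) (simp add: f_def flip: inner_eq_lor_time_reflect)
    have vf: "lor (v i) (f b) = - snd b" "lor (v i) (f b') = - snd b'" for i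
      using b f by blast+
    show ?thesis
    proof (cases "snd b = 0 \<and> snd b' = 0")
      case True
      then have n0: "fst b \<noteq> 0" "fst b' \<noteq> 0" using b by (auto simp: prod_eq_iff)
      then have "f b \<noteq> 0" by (simp add: f_def)
      have ind: "f b' \<noteq> k *\<^sub>R f b" for k
      proof
        assume "f b' = k *\<^sub>R f b"
        then have "fst b' = k *\<^sub>R fst b" by (simp add: f_def time_reflect_def prod_eq_iff)
        moreover have "fst b \<bullet> fst b' = 0" using b(3) True by (simp add: inner_prod_def)
        ultimately have "k = 0" using n0 by simp
        with \<open>fst b' = k *\<^sub>R fst b\<close> n0 show False by simp
      qed
      have v0: "lor (v i) (f b) = 0" "lor (v i) (f b') = 0" for i using vf True by auto
      from \<open>f b \<noteq> 0\<close> ind show ?thesis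
      proof (cases rule: plane_lightlike_or_positive)
        case (1 p q)
        then show ?thesis using v0
          by (intro disjI2 disjI1 exI[of _ "p *\<^sub>R f b + q *\<^sub>R f b'"]) (simp add: lor_simps)
      next
        case 2
        define u where "u = (1 / sqrt (lor (f b) (f b))) *\<^sub>R f b"
        define z where "z = (1 / sqrt (lor (f b') (f b'))) *\<^sub>R f b'"
        have uz: "spacelike_unit u" "spacelike_unit z"
          unfolding u_def z_def using 2 by (simp_all only: spacelike_scale_unit)
        have f_z: "f b' = sqrt (lor (f b') (f b')) *\<^sub>R z" using 2 by (simp add: z_def)
        have "z \<noteq> k *\<^sub>R u" for k
          using ind f_z unfolding u_def by (metis scaleR_scaleR)
        from this[of 1] this[of "-1"] have "z \<noteq> u" "z \<noteq> - u" by simp_all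
        then have ?inclined using uz v0
          by (intro exI[of _ u] exI[of _ z] exI[of _ 0]) (simp add: u_def z_def lor_simps)
        then show ?thesis by blast
      qed
    next
      case False
      define u where "u = snd b' *\<^sub>R f b - snd b *\<^sub>R f b'"
      have vu: "lor (v i) u = 0" for i using vf by (simp add: u_def lor_simps)
      have "u \<noteq> 0"
      proof
        assume "u = 0"
        then have "snd b' *\<^sub>R b = snd b *\<^sub>R b'"
          by (simp add: u_def f_def time_reflect_def prod_eq_iff mult.commute)
        from arg_cong[OF this, of "\<lambda>y. b \<bullet> y"] arg_cong[OF this, of "\<lambda>y. y \<bullet> b'"] show False
          using b False by simp
      qed
      obtain \<gamma> k where \<gamma>: "k \<noteq> 0" "lor (v i) \<gamma> = k" for i
        using False vf by (metis neg_equal_0_iff_equal)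
      then have "lor (v i) ((1 / k) *\<^sub>R \<gamma>) = 1" for i by (simp add: lor_simps)
      from affine_family_alternatives[OF v \<open>u \<noteq> 0\<close> vu this] show ?thesis .
    qed
  qed
qed

section \<open>The geometric conditions in terms of normals\<close>

text \<open>
  Tangency at infinity excludes \<open>v i = z\<close> and \<open>v i = - z\<close>, and these are precisely the cases of
  equal ideal boundaries.
\<close>

lemma share_tangent_hyperplane_iff:
  fixes P :: "'m \<Rightarrow> 'n::finite lorentz set"
  assumes n: "CARD('n) \<ge> 2" and v: "\<And>i. unit_normal (P i) (v i)"
  shows "share_tangent_hyperplane P \<longleftrightarrow> (\<exists>z. spacelike_unit z \<and> (\<forall>i. \<bar>lor (v i) z\<bar> = 1))"
proof -
  have tangent: "tangent_at_infinity Q (P i) \<or> ideal_boundary Q = ideal_boundary (P i) \<longleftrightarrow>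
      \<bar>lor (v i) z\<bar> = 1" if z: "unit_normal Q z" for Q z i
  proof -
    have "ideal_boundary Q = ideal_boundary (P i) \<longleftrightarrow> v i = z \<or> v i = - z"
    proof
      assume "ideal_boundary Q = ideal_boundary (P i)"
      then show "v i = z \<or> v i = - z" by (intro ideal_boundary_subset_imp[OF n z v]) simp
    next
      assume "v i = z \<or> v i = - z"
      then have "perp_plane (v i) = perp_plane z" by (elim disjE) simp_all
      then have "P i = Q" using unit_normalD[OF z] unit_normalD[OF v[of i]] by simp
      then show "ideal_boundary Q = ideal_boundary (P i)" by simp
    qed
    moreover have "\<bar>lor (v i) z\<bar> = 1" if "v i = z \<or> v i = - z"
      using that unit_normalD[OF z] by (elim disjE) (simp_all add: lor_simps)
    moreover have "lor z (v i) = lor (v i) z" by (rule lor_commute)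
    moreover have "tangent_at_infinity Q (P i) \<longleftrightarrow>
        \<bar>lor z (v i)\<bar> = 1 \<and> v i \<noteq> z \<and> v i \<noteq> - z"
      by (rule tangent_at_infinity_iff[OF z v])
    ultimately show ?thesis by argo
  qed
  show ?thesis
  proof
    assume "share_tangent_hyperplane P"
    then obtain Q where Q: "hyperplane Q"
      "\<forall>i. tangent_at_infinity Q (P i) \<or> ideal_boundary Q = ideal_boundary (P i)"
      unfolding share_tangent_hyperplane_def by blast
    then obtain z where z: "unit_normal Q z" unfolding hyperplane_iff_unit_normal by blast
    show "\<exists>z. spacelike_unit z \<and> (\<forall>i. \<bar>lor (v i) z\<bar> = 1)"
      using Q(2) unit_normalD[OF z] unfolding tangent[OF z] by (intro exI[of _ z]) simp
  next
    assume "\<exists>z. spacelike_unit z \<and> (\<forall>i. \<bar>lor (v i) z\<bar> = 1)"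
    then obtain z where z: "spacelike_unit z" "\<forall>i. \<bar>lor (v i) z\<bar> = 1" by blast
    then have n: "unit_normal (perp_plane z) z" by (simp add: unit_normal_def)
    then have "hyperplane (perp_plane z)" unfolding hyperplane_iff_unit_normal by blast
    with z(2) show "share_tangent_hyperplane P"
      unfolding share_tangent_hyperplane_def by (intro exI[of _ "perp_plane z"]) (simp add: tangent[OF n])
  qed
qed

lemma share_ideal_point_iff:
  assumes v: "\<And>i. unit_normal (P i) (v i)"
  shows "share_ideal_point P \<longleftrightarrow> (\<exists>w. lightlike w \<and> (\<forall>i. lor (v i) w = 0))"
proof
  assume "share_ideal_point P"
  then obtain L where "\<forall>i. L \<in> ideal_boundary (P i)" unfolding share_ideal_point_def by blast
  then have L: "\<exists>w. L = span {w} \<and> lightlike w \<and> lor w (v i) = 0" for i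
    unfolding ideal_boundary_iff[OF v] by (rule spec)
  from L[of undefined] obtain w where w: "L = span {w}" "lightlike w" by blast
  have "lor (v i) w = 0" for i
  proof -
    obtain w' where "span {w} = span {w'}" "lor w' (v i) = 0" using L[of i] w(1) by blast
    then show ?thesis by (subst lor_commute) (rule lightlike_span_orthogonal)
  qed
  then show "\<exists>w. lightlike w \<and> (\<forall>i. lor (v i) w = 0)" using w by blast
next
  assume "\<exists>w. lightlike w \<and> (\<forall>i. lor (v i) w = 0)"
  then obtain w where w: "lightlike w" "\<And>i. lor (v i) w = 0" by blast
  then have "lor w (v i) = 0" for i by (subst lor_commute)
  then have "span {w} \<in> ideal_boundary (P i)" for i
    using w(1) unfolding ideal_boundary_iff[OF v] by (intro exI[of _ w]) simp
  then show "share_ideal_point P"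
    unfolding share_ideal_point_def by (intro exI[of _ "span {w}"]) simp
qed

lemma abs_lor_unit_normals:
  assumes "unit_normal P v" "unit_normal P v'" "unit_normal Q u" "unit_normal Q u'"
  shows "\<bar>lor v' u'\<bar> = \<bar>lor v u\<bar>"
proof -
  have "v' = v \<or> v' = - v" "u' = u \<or> u' = - u"
    using unit_normal_unique assms by blast+
  then show ?thesis by (elim disjE) (simp_all add: lor_simps)
qed

lemma inclined_iff:
  assumes "unit_normal P v" "unit_normal Q u"
  shows "inclined l P Q \<longleftrightarrow> \<bar>lor v u\<bar> = l"
proof
  assume "inclined l P Q"
  then obtain v' u' where "unit_normal P v'" "unit_normal Q u'" "\<bar>lor v' u'\<bar> = l"
    unfolding inclined_def by blast
  then show "\<bar>lor v u\<bar> = l" using abs_lor_unit_normals assms by metis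
next
  assume "\<bar>lor v u\<bar> = l"
  with assms show "inclined l P Q"
    unfolding inclined_def by (intro exI[of _ v] exI[of _ u]) simp
qed

lemma orthogonal_planes_iff:
  assumes "unit_normal P v" "unit_normal Q u"
  shows "orthogonal_planes P Q \<longleftrightarrow> lor v u = 0"
  using inclined_iff[OF assms, of 0] by (simp add: inclined_def orthogonal_planes_def)

lemma orthogonal_and_equally_inclined_iff:
  assumes v: "\<And>i. unit_normal (P i) (v i)"
  shows "orthogonal_and_equally_inclined P \<longleftrightarrow>
    (\<exists>u z l. spacelike_unit u \<and> spacelike_unit z \<and> z \<noteq> u \<and> z \<noteq> - u \<and> 0 \<le> l \<and> l < 1 \<and>
      (\<forall>i. lor (v i) u = 0 \<and> \<bar>lor (v i) z\<bar> = l))"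
proof
  assume "orthogonal_and_equally_inclined P"
  then obtain Q R l where QR: "hyperplane Q" "hyperplane R" "Q \<noteq> R" "0 \<le> l" "l < 1"
    "\<And>i. orthogonal_planes (P i) Q" "\<And>i. inclined l (P i) R"
    unfolding orthogonal_and_equally_inclined_def by blast
  then obtain u z where u: "unit_normal Q u" and z: "unit_normal R z"
    unfolding hyperplane_iff_unit_normal by blast
  have "z \<noteq> u" "z \<noteq> - u" using QR(3) unit_normalD[OF u] unit_normalD[OF z] by auto
  then show "\<exists>u z l. spacelike_unit u \<and> spacelike_unit z \<and> z \<noteq> u \<and> z \<noteq> - u \<and> 0 \<le> l \<and> l < 1 \<and>
      (\<forall>i. lor (v i) u = 0 \<and> \<bar>lor (v i) z\<bar> = l)"
    using QR unit_normalD[OF u] unit_normalD[OF z] orthogonal_planes_iff[OF v u] inclined_iff[OF v z]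
    by (intro exI[of _ u] exI[of _ z] exI[of _ l]) simp
next
  assume "\<exists>u z l. spacelike_unit u \<and> spacelike_unit z \<and> z \<noteq> u \<and> z \<noteq> - u \<and> 0 \<le> l \<and> l < 1 \<and>
      (\<forall>i. lor (v i) u = 0 \<and> \<bar>lor (v i) z\<bar> = l)"
  then obtain u z l where uz: "spacelike_unit u" "spacelike_unit z" "z \<noteq> u" "z \<noteq> - u"
    and l: "0 \<le> l" "l < 1" "\<And>i. lor (v i) u = 0" "\<And>i. \<bar>lor (v i) z\<bar> = l" by blast
  then have u: "unit_normal (perp_plane u) u" and z: "unit_normal (perp_plane z) z"
    by (simp_all add: unit_normal_def)
  have "perp_plane u \<noteq> perp_plane z" using perp_plane_subset_imp[OF uz(1,2)] uz by blast
  moreover have "hyperplane (perp_plane u)" "hyperplane (perp_plane z)"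
    unfolding hyperplane_iff_unit_normal using u z by blast+
  ultimately show "orthogonal_and_equally_inclined P"
    unfolding orthogonal_and_equally_inclined_def
    using l orthogonal_planes_iff[OF v u] inclined_iff[OF v z]
    by (intro exI[of _ "perp_plane u"] exI[of _ "perp_plane z"] exI[of _ l]) simp
qed

text \<open>The freedom to choose coorientations removes absolute values.\<close>

lemma coorient_towards:
  assumes v: "\<And>i. unit_normal (P i) (v i)" and z: "\<And>i. \<bar>lor (v i) z\<bar> = l"
  shows "\<exists>v'. (\<forall>i. unit_normal (P i) (v' i)) \<and> (\<forall>i. lor (v' i) z = l)"
proof (intro exI conjI allI)
  define v' where "v' = (\<lambda>i. if lor (v i) z \<ge> 0 then v i else - v i)"
  show "unit_normal (P i) (v' i)" for i
    using v[of i] unit_normal_uminus[OF v[of i]] by (simp add: v'_def)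
  show "lor (v' i) z = l" for i using z[of i] by (auto simp: v'_def lor_simps)
qed

theorem theoremC:
  fixes P :: "'m::finite \<Rightarrow> 'n::finite lorentz set"
  assumes "CARD('n) \<ge> 2"
    and "CARD('m) = CARD('n) + 1"
    and "\<And>i. hyperplane (P i)"
  shows "(\<exists>v. (\<forall>i. unit_normal (P i) (v i)) \<and>
            det (\<chi> i j. coor_sigma (v i) (v j)) = 0) \<longleftrightarrow>
         share_tangent_hyperplane P \<or>
         share_ideal_point P \<or>
         orthogonal_and_equally_inclined P"
proof
  assume "\<exists>v. (\<forall>i. unit_normal (P i) (v i)) \<and> det (\<chi> i j. coor_sigma (v i) (v j)) = 0"
  then obtain v where v: "\<And>i. unit_normal (P i) (v i)"
    and det: "det (\<chi> i j. coor_sigma (v i) (v j)) = 0" by blast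
  have sp: "spacelike_unit (v i)" for i using v by (simp add: unit_normal_def)
  obtain x :: "real^'m" where "x \<noteq> 0"
    "\<And>i. lor (v i) (\<Sum>j\<in>UNIV. x $ j *\<^sub>R v j) = (\<Sum>j\<in>UNIV. x $ j)"
    using det unfolding det_coor_sigma_eq_0_iff[OF sp] by blast
  from singular_imp_alternatives[OF assms(2) sp this]
  show "share_tangent_hyperplane P \<or> share_ideal_point P \<or> orthogonal_and_equally_inclined P"
    unfolding share_tangent_hyperplane_iff[OF assms(1) v, symmetric]
      share_ideal_point_iff[OF v, symmetric] orthogonal_and_equally_inclined_iff[OF v, symmetric] .
next
  have "\<forall>i. \<exists>v. unit_normal (P i) v" using assms(3) hyperplane_iff_unit_normal by blast
  then obtain v where v: "\<And>i. unit_normal (P i) (v i)" by metis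
  have singular: "\<exists>v. (\<forall>i. unit_normal (P i) (v i)) \<and> det (\<chi> i j. coor_sigma (v i) (v j)) = 0"
    if v': "\<And>i. unit_normal (P i) (v' i)"
      and x: "\<exists>x :: real^'m. x \<noteq> 0 \<and>
        (\<forall>i. lor (v' i) (\<Sum>j\<in>UNIV. x $ j *\<^sub>R v' j) = (\<Sum>j\<in>UNIV. x $ j))" for v'
  proof -
    have "spacelike_unit (v' i)" for i using v' by (simp add: unit_normal_def)
    then have "det (\<chi> i j. coor_sigma (v' i) (v' j)) = 0"
      using x by (simp only: det_coor_sigma_eq_0_iff)
    with v' show ?thesis by blast
  qed
  assume "share_tangent_hyperplane P \<or> share_ideal_point P \<or> orthogonal_and_equally_inclined P"
  then consider (tangent) z where "spacelike_unit z" "\<And>i. \<bar>lor (v i) z\<bar> = 1"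
    | (ideal) w where "lightlike w" "\<And>i. lor (v i) w = 0"
    | (inclined) u z l where "spacelike_unit u" "spacelike_unit z" "z \<noteq> u" "z \<noteq> - u"
        "\<And>i. lor (v i) u = 0" "\<And>i. \<bar>lor (v i) z\<bar> = l"
    unfolding share_tangent_hyperplane_iff[OF assms(1) v] share_ideal_point_iff[OF v]
      orthogonal_and_equally_inclined_iff[OF v] by blast
  then show "\<exists>v. (\<forall>i. unit_normal (P i) (v i)) \<and> det (\<chi> i j. coor_sigma (v i) (v j)) = 0"
  proof cases
    case tangent
    have "\<exists>v'. (\<forall>i. unit_normal (P i) (v' i)) \<and> (\<forall>i. lor (v' i) z = 1)"
      by (rule coorient_towards[OF v tangent(2)])
    then obtain v' where v': "\<forall>i. unit_normal (P i) (v' i)" "\<forall>i. lor (v' i) z = 1" by blast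
    show ?thesis
      by (rule singular[OF spec[OF v'(1)]
            tangent_imp_singular[OF assms(2) tangent(1) spec[OF v'(2)]]])
  next
    case ideal
    show ?thesis by (rule singular[OF v ideal_point_imp_singular[OF assms(2) ideal]])
  next
    case inclined
    have "\<exists>v'. (\<forall>i. unit_normal (P i) (v' i)) \<and> (\<forall>i. lor (v' i) z = l)"
      by (rule coorient_towards[OF v inclined(6)])
    then obtain v' where v': "\<forall>i. unit_normal (P i) (v' i)" "\<forall>i. lor (v' i) z = l" by blast
    have u: "lor (v' i) u = 0" for i
      using unit_normal_unique[OF v spec[OF v'(1)], of i] inclined(5)[of i]
      by (elim disjE) (simp_all add: lor_simps)
    show ?thesis
      by (rule singular[OF spec[OF v'(1)]
            inclined_imp_singular[OF assms(2) inclined(1-4) u spec[OF v'(2)]]])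
  qed
qed

end
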